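(* Let $C = V(f)$ and $D = V(g)$ be real symmetric curves in $\mathbb{P}^2_{\mathbb{C}}$ of degrees $d$ and $e$ respectively, which intersect transversely. \begin{enumerate} \item[(a)] If $de \equiv 3$ or $5 \pmod 6$, then $V(f,g)$ has exactly $3+6k$ real points for some integer $k$ with $0 \leq k < de/6$. \item[(b)] If $de \equiv 0$ or $2 \pmod 6$, then $V(f,g)$ has exactly $6k$ real points for some integer $k$ with $0 \leq k \leq de/6$. \end{enumerate}
   Context: A real symmetric curve of degree $d \geq 1$ is the curve $V(f) \subseteq \mathbb{P}^2_{\mathbb{C}}$ defined by a nonzero homogeneous polynomial $f \in \mathbb{R}[X,Y,Z]$ of degree $d$ that is invariant under all permutations of $X,Y,Z$. Two curves $V(f), V(g)$ intersect transversely (are transverse) if at every point of $V(f,g) \subseteq \mathbb{P}^2_{\mathbb{C}}$ (the set of common complex zeros) their intersection multiplicity is $1$, equivalently both curves are nonsingular there with distinct tangent lines. A real point of $V(f,g)$ is a point that admits homogeneous coordinates all of which are real. *)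

theory Defs
  imports
    "HOL-Analysis.Analysis"
    "HOL-Computational_Algebra.Computational_Algebra"
    "HOL-Library.Extended_Nat"
begin

text \<open>
  The polynomial ring \<open>K[X,Y,Z]\<close> is rendered as the iterated polynomial ring \<open>K[X][Y][Z]\<close>,
  the outermost variable being \<open>Z\<close>. The coordinates \<open>1, 2, 3\<close> of the index type correspond
  to \<open>X, Y, Z\<close> (in this type \<open>3 = 0\<close>).
\<close>

type_synonym 'a poly3 = "'a poly poly poly"

text \<open>The coefficient of \<open>X^(m 1) Y^(m 2) Z^(m 3)\<close>.\<close>

definition coeff3 :: "'a::zero poly3 \<Rightarrow> (3 \<Rightarrow> nat) \<Rightarrow> 'a" where
  "coeff3 f m = coeff (coeff (coeff f (m 3)) (m 2)) (m 1)"

definition eval3 :: "'a::comm_ring_1 poly3 \<Rightarrow> 'a ^ 3 \<Rightarrow> 'a" where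
  "eval3 f v = poly (poly (poly f [:[:v $ 3:]:]) [:v $ 2:]) (v $ 1)"

text \<open>As usual, the zero polynomial is homogeneous of every degree.\<close>

definition homogeneous3 :: "nat \<Rightarrow> 'a::zero poly3 \<Rightarrow> bool" where
  "homogeneous3 d f \<longleftrightarrow> (\<forall>m. coeff3 f m \<noteq> 0 \<longrightarrow> (\<Sum>i\<in>UNIV. m i) = d)"

definition symmetric3 :: "'a::zero poly3 \<Rightarrow> bool" where
  "symmetric3 f \<longleftrightarrow> (\<forall>\<pi>. bij \<pi> \<longrightarrow> (\<forall>m. coeff3 f (m \<circ> \<pi>) = coeff3 f m))"

definition real_symmetric_curve :: "nat \<Rightarrow> real poly3 \<Rightarrow> bool" where
  "real_symmetric_curve d f \<longleftrightarrow> d \<ge> 1 \<and> f \<noteq> 0 \<and> homogeneous3 d f \<and> symmetric3 f"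

definition complexify :: "real poly3 \<Rightarrow> complex poly3" where
  "complexify f = map_poly (map_poly (map_poly complex_of_real)) f"

text \<open>A point of the complex projective plane is the set of all its homogeneous coordinate vectors.\<close>

type_synonym point = "(complex ^ 3) set"

definition proj_plane :: "point set" where
  "proj_plane = (UNIV - {0}) // {(v, w). v \<noteq> 0 \<and> (\<exists>c. c \<noteq> 0 \<and> w = c *s v)}"

definition common_zeros :: "real poly3 \<Rightarrow> real poly3 \<Rightarrow> point set" where
  "common_zeros f g =
     {p \<in> proj_plane. \<forall>v\<in>p. eval3 (complexify f) v = 0 \<and> eval3 (complexify g) v = 0}"

definition real_point :: "point \<Rightarrow> bool" where
  "real_point p \<longleftrightarrow> (\<exists>v\<in>p. \<forall>i. v $ i \<in> \<real>)"

text \<open>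
  The local ring of the projective plane at \<open>p\<close>, inside the fraction field of \<open>\<complex>[X,Y,Z]\<close>:
  quotients of forms of equal degree whose denominator does not vanish at \<open>p\<close>.
\<close>

definition local_ring :: "point \<Rightarrow> complex poly3 fract set" where
  "local_ring p = {Fract a b | a b. (\<exists>n. homogeneous3 n a \<and> homogeneous3 n b) \<and>
     (\<forall>v\<in>p. eval3 b v \<noteq> 0)}"

text \<open>
  The ideal of the local ring at \<open>p\<close> generated by the local equations \<open>f/L^d\<close>, \<open>g/L^e\<close> of two
  forms of degrees \<open>d, e\<close>, where \<open>L\<close> is a linear form with \<open>L(p) \<noteq> 0\<close>; equivalently, the
  degree-zero part of the localisation at \<open>p\<close> of the homogeneous ideal \<open>(f, g)\<close>. The latter
  description does not involve the choice of \<open>L\<close>.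
\<close>

definition local_ideal :: "complex poly3 \<Rightarrow> complex poly3 \<Rightarrow> point \<Rightarrow> complex poly3 fract set" where
  "local_ideal f g p = {Fract a b | a b. (\<exists>n. homogeneous3 n a \<and> homogeneous3 n b) \<and>
     (\<forall>v\<in>p. eval3 b v \<noteq> 0) \<and> (\<exists>r s. a = r * f + s * g)}"

text \<open>
  The intersection multiplicity is the dimension over \<open>\<complex>\<close> of the quotient of the local ring by
  this ideal. The dimension is the least size of a finite set \<open>B\<close> whose residue classes span the
  quotient, and \<open>\<infinity>\<close> if there is none.
\<close>

definition intersection_multiplicity :: "real poly3 \<Rightarrow> real poly3 \<Rightarrow> point \<Rightarrow> enat" where
  "intersection_multiplicity f g p =
     (INF B \<in> {B. finite B \<and> B \<subseteq> local_ring p \<and>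
         (\<forall>q\<in>local_ring p. \<exists>c :: complex poly3 fract \<Rightarrow> complex.
            q - (\<Sum>b\<in>B. Fract [:[:[:c b:]:]:] 1 * b)
              \<in> local_ideal (complexify f) (complexify g) p)}. enat (card B))"

definition transverse :: "real poly3 \<Rightarrow> real poly3 \<Rightarrow> bool" where
  "transverse f g \<longleftrightarrow> (\<forall>p\<in>common_zeros f g. intersection_multiplicity f g p = 1)"

definition real_common_zeros :: "real poly3 \<Rightarrow> real poly3 \<Rightarrow> point set" where
  "real_common_zeros f g = {p \<in> common_zeros f g. real_point p}"

end

(*
  Transversality forces the gradients of the two forms to be independent at every common zero: a
  common tangent vector w at v would give a second linear functional on the local ring, the
  derivative at t = 0 along v + t w, which together with the value at v vanishes on the ideal.

  Symmetry produces such common tangent vectors at all points with a nontrivial stabiliser. If two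
  coordinates agree, both forms are even along the difference of the two axes. At (1 : -1 : 0) and
  its images a form of even degree is singular, while a form of odd degree vanishes automatically.
  So these three points are common zeros exactly if d and e are odd, and S_3 acts freely on the
  other real common zeros (over the reals the only eigenvalues of a permutation matrix are 1, -1).

  The upper bound is the weak form of Bezout's theorem: in an affine chart whose first coordinate
  separates the given common zeros, these coordinates are roots of the resultant, which has degree
  at most d e. It is nonzero since at a zero of a common factor of positive degree both forms would
  be tangent to a common direction.
*)

theory Submission
  imports Defs "Subresultants.Subresultant_Gcd" "HOL-Computational_Algebra.Field_as_Ring"
begin

text \<open>Both notations compete with the component access \<open>$\<close> of \<open>'a ^ 'n\<close>.\<close>

no_notation fps_nth (infixl "$" 75)
no_notation Matrix.vec_index (infixl "$" 100)

section \<open>Resultants of bivariate polynomials\<close>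

text \<open>\<open>'a poly poly\<close> is read as K[x][z] with z outermost. Quantifying over
  nonzero coefficients gives the zero polynomial every bound.\<close>

definition total_degree_le :: "nat \<Rightarrow> 'a::zero poly poly \<Rightarrow> bool" where
  "total_degree_le d F \<longleftrightarrow> (\<forall>i. coeff F i \<noteq> 0 \<longrightarrow> degree (coeff F i) + i \<le> d)"

lemma total_degree_le_degree:
  assumes "total_degree_le d F"
  shows "degree F \<le> d"
proof (cases "F = 0")
  case False
  then show ?thesis using assms unfolding total_degree_le_def
    by (metis leading_coeff_neq_0 add_leE)
qed simp

lemma total_degree_le_0: "total_degree_le d 0"
  by (simp add: total_degree_le_def)

lemma total_degree_le_const: "total_degree_le 0 [:[:c:]:]"
  unfolding total_degree_le_def
proof (intro allI impI)
  fix i assume "coeff [:[:c:]:] i \<noteq> 0"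
  then show "degree (coeff [:[:c:]:] i) + i \<le> 0" by (cases i) simp_all
qed

lemma total_degree_le_linear: "total_degree_le 1 [:[:b, a:], [:c:]:]"
  unfolding total_degree_le_def
proof (intro allI impI)
  fix i assume nz: "coeff [:[:b, a:], [:c:]:] i \<noteq> 0"
  then consider "i = 0" | "i = 1" by (cases i; cases "i - 1") simp_all
  then show "degree (coeff [:[:b, a:], [:c:]:] i) + i \<le> 1" by cases (simp_all add: degree_pCons_eq_if)
qed

lemma total_degree_le_add:
  fixes F G :: "'a::ab_group_add poly poly"
  assumes "total_degree_le d F" "total_degree_le d G"
  shows "total_degree_le d (F + G)"
  unfolding total_degree_le_def
proof (intro allI impI)
  have zero: "coeff H j = 0" if "total_degree_le d H" "d < j" for H :: "'a poly poly" and j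
    using that unfolding total_degree_le_def by (metis add_leE not_le)
  fix i assume "coeff (F + G) i \<noteq> 0"
  then have i: "i \<le> d" using zero[OF assms(1), of i] zero[OF assms(2), of i] by (cases "d < i") auto
  have "degree (coeff H i) \<le> d - i" if "total_degree_le d H" for H :: "'a poly poly"
    using that unfolding total_degree_le_def by (cases "coeff H i = 0") (simp, fastforce)
  then have "degree (coeff F i + coeff G i) \<le> d - i"
    using assms degree_add_le by blast
  then show "degree (coeff (F + G) i) + i \<le> d" using i by simp
qed

lemma total_degree_le_sum:
  fixes F :: "'b \<Rightarrow> 'a::ab_group_add poly poly"
  assumes "\<And>x. x \<in> S \<Longrightarrow> total_degree_le d (F x)"
  shows "total_degree_le d (\<Sum>x\<in>S. F x)"
  using assms by (induction S rule: infinite_finite_induct) (auto intro: total_degree_le_0 total_degree_le_add)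

lemma total_degree_le_mult:
  fixes F G :: "'a::comm_ring_1 poly poly"
  assumes F: "total_degree_le d F" and G: "total_degree_le e G"
  shows "total_degree_le (d + e) (F * G)"
  unfolding total_degree_le_def
proof (intro allI impI)
  fix k assume "coeff (F * G) k \<noteq> 0"
  then have ne: "(\<Sum>i\<le>k. coeff F i * coeff G (k - i)) \<noteq> 0" by (simp add: coeff_mult)
  have product: "degree (coeff F i * coeff G (k - i)) + k \<le> d + e"
    if "i \<le> k" and nz: "coeff F i * coeff G (k - i) \<noteq> 0" for i
  proof -
    have "coeff F i \<noteq> 0" "coeff G (k - i) \<noteq> 0" using nz by auto
    then have "degree (coeff F i) + i \<le> d" "degree (coeff G (k - i)) + (k - i) \<le> e"
      using F G unfolding total_degree_le_def by auto
    moreover have "degree (coeff F i * coeff G (k - i)) \<le> degree (coeff F i) + degree (coeff G (k - i))"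
      by (rule degree_mult_le)
    ultimately show ?thesis using that(1) by simp
  qed
  \<comment> \<open>One nonzero summand already gives \<open>k \<le> d + e\<close>, so the natural
    subtraction \<open>d + e - k\<close> below is not truncated.\<close>
  obtain i where "i \<le> k" "coeff F i * coeff G (k - i) \<noteq> 0"
    using ne by (meson atMost_iff sum.neutral)
  then have k: "k \<le> d + e" using product by fastforce
  have "degree (\<Sum>i\<le>k. coeff F i * coeff G (k - i)) \<le> d + e - k"
  proof (rule degree_sum_le)
    fix i assume "i \<in> {..k}"
    then show "degree (coeff F i * coeff G (k - i)) \<le> d + e - k"
      using product[of i] by (cases "coeff F i * coeff G (k - i) = 0") auto
  qed simp
  then show "degree (coeff (F * G) k) + k \<le> d + e" using k by (simp add: coeff_mult)
qed

lemma total_degree_le_power: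
  fixes F :: "'a::comm_ring_1 poly poly"
  assumes "total_degree_le 1 F"
  shows "total_degree_le n (F ^ n)"
proof (induction n)
  case 0
  show ?case unfolding power_0 one_pCons by (rule total_degree_le_const)
next
  case (Suc n)
  then show ?case using total_degree_le_mult[OF assms Suc] by simp
qed

section \<open>Degree and zeros of the resultant\<close>

text \<open>In the Sylvester matrix the entry in row i and column j has degree at most d - m + j - i
  in the n rows of \<open>F\<close> and at most e + j - i in the m rows of \<open>G\<close>. In each
  Leibniz product the terms j - i cancel, leaving n(d - m) + me, which is at most de.\<close>

lemma degree_resultant_le:
  fixes F G :: "'a::idom poly poly"
  assumes F: "total_degree_le d F" and G: "total_degree_le e G"
  shows "degree (resultant F G) \<le> d * e"
proof -
  define m n where "m = degree F" and "n = degree G"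
  define M where "M = sylvester_mat F G"
  have car: "M \<in> carrier_mat (m + n) (m + n)"
    unfolding M_def m_def n_def by (rule sylvester_carrier_mat)
  have md: "m \<le> d" "n \<le> e"
    using total_degree_le_degree F G unfolding m_def n_def by blast+
  have "degree (signof p * (\<Prod>i = 0..<m + n. M $$ (i, p i))) \<le> d * e"
    if p: "p permutes {0..<m + n}" for p
  proof (cases "(\<Prod>i = 0..<m + n. M $$ (i, p i)) = 0")
    case True
    show ?thesis unfolding True by simp
  next
    case False
    \<comment> \<open>The entrywise bound, rearranged to avoid subtraction of naturals.\<close>
    have entry: "degree (M $$ (i, p i)) + i + (if i < n then m else 0) \<le> p i + (if i < n then d else e)"
      if i: "i \<in> {0..<m + n}" for i
    proof -
      have nz: "M $$ (i, p i) \<noteq> 0"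
        using False i by auto
      have pi: "p i < m + n"
        using permutes_in_image[OF p, of i] i by auto
      have idx: "M $$ (i, p i) =
        (if i < n then if i \<le> p i \<and> p i - i \<le> m then coeff F (m + i - p i) else 0
         else if i - n \<le> p i \<and> p i \<le> i then coeff G (i - p i) else 0)"
        unfolding M_def m_def n_def by (rule sylvester_index_mat) (use i pi in \<open>auto simp: m_def n_def\<close>)
      show ?thesis
      proof (cases "i < n")
        case True
        then have "M $$ (i, p i) = coeff F (m + i - p i)" "p i - i \<le> m" "i \<le> p i"
          using idx nz by (auto split: if_splits)
        then show ?thesis using F nz True unfolding total_degree_le_def by fastforce
      next
        case False
        then have "M $$ (i, p i) = coeff G (i - p i)" "p i \<le> i"
          using idx nz by (auto split: if_splits)
        then show ?thesis using G nz False unfolding total_degree_le_def by fastforce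
      qed
    qed
    have split: "(\<Sum>i = 0..<m + n. if i < n then a else b) = n * a + m * b" for a b :: nat
    proof -
      have "{0..<m + n} = {0..<n} \<union> {n..<m + n}" by auto
      then have "(\<Sum>i = 0..<m + n. if i < n then a else b) =
          (\<Sum>i = 0..<n. if i < n then a else b) + (\<Sum>i = n..<m + n. if i < n then a else b)"
        by (simp add: sum.union_disjoint)
      then show ?thesis by simp
    qed
    have "(\<Sum>i = 0..<m + n. degree (M $$ (i, p i)) + i + (if i < n then m else 0))
        \<le> (\<Sum>i = 0..<m + n. p i + (if i < n then d else e))"
      by (rule sum_mono) (rule entry)
    moreover have "(\<Sum>i = 0..<m + n. p i) = (\<Sum>i = 0..<m + n. i)"
      using sum.permute[OF p, of id] by (simp add: comp_def)
    ultimately have "(\<Sum>i = 0..<m + n. degree (M $$ (i, p i))) + n * m \<le> n * d + m * e"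
      by (simp add: sum.distrib split)
    \<comment> \<open>This is (d - m)(e - n) >= 0.\<close>
    moreover have "n * d + m * e \<le> d * e + n * m"
    proof -
      obtain a b where "d = m + a" "e = n + b" using md le_Suc_ex by metis
      then show ?thesis by (simp add: algebra_simps)
    qed
    ultimately have "(\<Sum>i = 0..<m + n. degree (M $$ (i, p i))) \<le> d * e" by simp
    then have "degree (\<Prod>i = 0..<m + n. M $$ (i, p i)) \<le> d * e"
      using degree_prod_sum_le[of "{0..<m + n}" "\<lambda>i. M $$ (i, p i)"] by (simp add: comp_def)
    then show ?thesis by (cases "sign p = 1") (auto simp: sign_def)
  qed
  then have "degree (det M) \<le> d * e"
    unfolding det_def'[OF car] by (intro degree_sum_le) (auto simp: finite_permutations)
  then show ?thesis unfolding resultant_def M_def .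
qed

text \<open>The Sylvester matrix maps the vector of powers of z to multiples of F(z) and G(z), which
  vanish at x. Multiplying by the adjugate shows that the determinant vanishes at x. The resultant
  is never specialised at x, where leading coefficients may drop.\<close>

lemma poly_resultant_eq_0:
  fixes F G :: "'a::idom poly poly"
  assumes F: "poly (poly F [:z:]) x = 0" and G: "poly (poly G [:z:]) x = 0"
    and pos: "degree F + degree G > 0"
  shows "poly (resultant F G) x = 0"
proof -
  define m n where "m = degree F" and "n = degree G"
  define N where "N = m + n"
  define M where "M = sylvester_mat F G"
  have car: "M \<in> carrier_mat N N"
    unfolding M_def m_def n_def N_def by (rule sylvester_carrier_mat)
  define A where "A = adj_mat M"
  have carA: "A \<in> carrier_mat N N" and adj: "A * M = det M \<cdot>\<^sub>m 1\<^sub>m N"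
    using adj_mat[OF car] unfolding A_def by auto
  \<comment> \<open>Descending powers, so that the last entry is 1 and the last component of det(M)
    u is the determinant itself.\<close>
  define u where "u = Matrix.vec N (\<lambda>j. [:z:] ^ (N - 1 - j))"
  have caru: "u \<in> carrier_vec N" unfolding u_def by simp
  have N: "N > 0" using pos unfolding N_def m_def n_def .
  \<comment> \<open>\<open>sylvester_index_mat2\<close> reads the rows as coefficients at
    \<open>N - j\<close>; one factor z in \<open>monom 1 (Suc k)\<close> absorbs the shift from
    \<open>N - 1 - j\<close>.\<close>
  have shifted: "(\<Sum>j = 0..<N. coeff (monom 1 (Suc k) * P) (N - j) * [:z:] ^ (N - 1 - j))
      = [:z:] ^ k * poly P [:z:]" if "k + degree P < N" for k and P :: "'a poly poly"
  proof -
    have "(\<Sum>j = 0..<N. coeff (monom 1 (Suc k) * P) (N - j) * [:z:] ^ (N - 1 - j))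
        = (\<Sum>j = 0..<N. coeff (monom 1 k * P) (N - 1 - j) * [:z:] ^ (N - 1 - j))"
      by (rule sum.cong) (auto simp: coeff_monom_mult Suc_diff_Suc)
    also have "\<dots> = (\<Sum>j<N. coeff (monom 1 k * P) j * [:z:] ^ j)"
      by (rule sum.reindex_bij_witness[of _ "\<lambda>j. N - 1 - j" "\<lambda>j. N - 1 - j"]) auto
    also have "\<dots> = (\<Sum>j\<le>degree (monom 1 k * P). coeff (monom 1 k * P) j * [:z:] ^ j)"
    proof (rule sum.mono_neutral_right)
      have "degree (monom 1 k * P) \<le> k + degree P"
        using degree_mult_le[of "monom 1 k" P] degree_monom_le[of 1 k] by (smt (verit) add_right_mono le_trans)
      then show "{..degree (monom 1 k * P)} \<subseteq> {..<N}" using that by auto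
    qed (auto simp: coeff_eq_0)
    also have "\<dots> = poly (monom 1 k * P) [:z:]" by (simp add: poly_altdef)
    finally show ?thesis by (simp add: poly_monom)
  qed
  have row: "poly (vec_index (M *\<^sub>v u) i) x = 0" if i: "i < N" for i
  proof -
    have "vec_index (M *\<^sub>v u) i = (\<Sum>j = 0..<N. M $$ (i, j) * vec_index u j)"
      using i car caru by (simp add: scalar_prod_def)
    also have "\<dots> = (\<Sum>j = 0..<N. (if i < n then coeff (monom 1 (n - i) * F) (N - j)
        else coeff (monom 1 (N - i) * G) (N - j)) * [:z:] ^ (N - 1 - j))"
      unfolding M_def N_def m_def n_def
      by (intro sum.cong refl, subst sylvester_index_mat2)
         (use i in \<open>auto simp: u_def N_def m_def n_def\<close>)
    also have "poly \<dots> x = 0"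
    proof (cases "i < n")
      case True
      then obtain k where k: "n - i = Suc k" by (metis Suc_diff_Suc)
      have "k + degree F < N" using k True unfolding N_def m_def by simp
      from shifted[OF this] show ?thesis using True k F by simp
    next
      case False
      then obtain k where k: "N - i = Suc k" using i by (metis Suc_diff_Suc)
      have "k + degree G < N" using k False i unfolding N_def n_def[symmetric] by simp
      from shifted[OF this] show ?thesis using False k G by simp
    qed
    finally show ?thesis .
  qed
  have "det M * vec_index u (N - 1) = vec_index ((A * M) *\<^sub>v u) (N - 1)"
    unfolding adj using N by (simp add: scalar_prod_def u_def mult.assoc flip: sum_distrib_left)
       (simp add: if_distrib[of "\<lambda>a. a * _"] sum.delta cong: if_cong)
  also have "\<dots> = vec_index (A *\<^sub>v (M *\<^sub>v u)) (N - 1)" using carA car caru by simp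
  finally have "det M * vec_index u (N - 1) = vec_index (A *\<^sub>v (M *\<^sub>v u)) (N - 1)" .
  then have "det M = (\<Sum>j = 0..<N. A $$ (N - 1, j) * vec_index (M *\<^sub>v u) j)"
    using N carA car by (simp add: scalar_prod_def u_def)
  then have "poly (det M) x = (\<Sum>j = 0..<N. poly (A $$ (N - 1, j)) x * poly (vec_index (M *\<^sub>v u) j) x)"
    by (simp add: poly_sum)
  also have "\<dots> = 0" using row by simp
  finally show ?thesis unfolding resultant_def M_def .
qed

text \<open>The abscissae are roots of a nonzero polynomial in x of degree at most de. Only common
  factors of positive degree in z are excluded: a common factor in x alone still leaves finitely
  many abscissae.\<close>

lemma card_common_abscissae_le:
  fixes F G :: "complex poly poly"
  assumes F: "total_degree_le d F" and G: "total_degree_le e G" and "F \<noteq> 0" and "e \<ge> 1"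
    and gcd: "degree (gcd F G) = 0"
  defines "S \<equiv> {x. \<exists>z. poly (poly F [:z:]) x = 0 \<and> poly (poly G [:z:]) x = 0}"
  shows "finite S" "card S \<le> d * e"
proof -
  obtain R where R: "R \<noteq> 0" "degree R \<le> d * e" "S \<subseteq> {x. poly R x = 0}"
  proof (cases "degree F + degree G > 0")
    case True
    show ?thesis
    proof (rule that[of "resultant F G"])
      show "resultant F G \<noteq> 0" using gcd resultant_0_gcd[of F G] by simp
      show "degree (resultant F G) \<le> d * e" by (rule degree_resultant_le[OF F G])
      show "S \<subseteq> {x. poly (resultant F G) x = 0}"
        unfolding S_def using poly_resultant_eq_0[OF _ _ True] by blast
    qed
  \<comment> \<open>Both polynomials are constant in z, so \<open>F\<close> itself is a polynomial
    in x; its degree is at most d, hence at most de as \<open>e \<ge> 1\<close>.\<close>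
  next
    case False
    then obtain F0 where F0: "F = [:F0:]" using degree_eq_zeroE by blast
    show ?thesis
    proof (rule that[of F0])
      show "F0 \<noteq> 0" using \<open>F \<noteq> 0\<close> F0 by simp
      then have "degree F0 \<le> d" using F F0 unfolding total_degree_le_def by (auto dest: spec[of _ 0])
      then show "degree F0 \<le> d * e" using \<open>e \<ge> 1\<close> by (metis mult_le_mono nat_mult_1_right)
      show "S \<subseteq> {x. poly F0 x = 0}" unfolding S_def F0 by auto
    qed
  qed
  show "finite S" using R(1,3) poly_roots_finite finite_subset by blast
  have "card S \<le> card {x. poly R x = 0}" using R(1,3) poly_roots_finite card_mono by blast
  then show "card S \<le> d * e" using card_poly_roots_bound[OF R(1)] R(2) by linarith
qed

section \<open>Forms in three variables\<close>

lemma poly_eq_sum_le: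
  fixes p :: "'a::comm_semiring_1 poly"
  assumes "degree p \<le> n"
  shows "poly p x = (\<Sum>i\<le>n. coeff p i * x ^ i)"
  unfolding poly_altdef
  by (rule sum.mono_neutral_left) (use assms in \<open>auto simp: coeff_eq_0\<close>)

lemma prod_3: "prod f (UNIV :: 3 set) = f 1 * f 2 * f 3"
  unfolding UNIV_3 by (simp add: mult.assoc)

text \<open>A cube instead of the simplex of total degree n: it contains all exponents of a form of
  degree n, corresponds to the triples of a nested sum, and is stable under permutations.\<close>

definition exponents :: "nat \<Rightarrow> (3 \<Rightarrow> nat) set" where
  "exponents n = {m. \<forall>i. m i \<le> n}"

text \<open>Passes from nested evaluation to a sum over monomials, where homogeneity and symmetry,
  both stated through \<open>coeff3\<close>, can be applied.\<close>

lemma eval3_eq_sum: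
  fixes f :: "'a::comm_ring_1 poly3"
  assumes bound: "\<And>m. coeff3 f m \<noteq> 0 \<Longrightarrow> m \<in> exponents n"
  shows "eval3 f v = (\<Sum>m\<in>exponents n. coeff3 f m * (\<Prod>i\<in>UNIV. v $ i ^ m i))"
proof -
  \<comment> \<open>The exponent function with values k, j, i at X, Y, Z; the outermost coefficient
    index i belongs to Z.\<close>
  define mk :: "nat \<Rightarrow> nat \<Rightarrow> nat \<Rightarrow> 3 \<Rightarrow> nat"
    where "mk k j i = (\<lambda>l. if l = 1 then k else if l = 2 then j else i)" for k j i
  have mk: "mk k j i 1 = k" "mk k j i 2 = j" "mk k j i 3 = i" for k j i
    unfolding mk_def by auto
  have zero: "coeff (coeff (coeff f i) j) k = 0" if "i > n \<or> j > n \<or> k > n" for i j k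
    using bound[of "mk k j i"] that unfolding coeff3_def mk exponents_def
    by (metis mk linorder_not_le mem_Collect_eq)
  have deg1: "degree (coeff (coeff f i) j) \<le> n" for i j
    by (rule degree_le) (use zero in auto)
  have deg2: "degree (coeff f i) \<le> n" for i
    by (rule degree_le) (use zero in \<open>auto simp: poly_eq_iff\<close>)
  have deg3: "degree f \<le> n"
    by (rule degree_le) (use zero in \<open>auto simp: poly_eq_iff\<close>)
  have "eval3 f v = (\<Sum>i\<le>n. \<Sum>j\<le>n. \<Sum>k\<le>n.
      coeff (coeff (coeff f i) j) k * (v $ 1 ^ k * v $ 2 ^ j * v $ 3 ^ i))"
    unfolding eval3_def poly_eq_sum_le[OF deg3] poly_sum poly_mult poly_power poly_eq_sum_le[OF deg2]
      poly_eq_sum_le[OF deg1] poly_pCons poly_0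
    by (simp add: sum_distrib_right sum_distrib_left mult_ac)
  also have "\<dots> = (\<Sum>(i, j, k)\<in>{..n} \<times> {..n} \<times> {..n}.
      coeff (coeff (coeff f i) j) k * (v $ 1 ^ k * v $ 2 ^ j * v $ 3 ^ i))"
    by (simp add: sum.cartesian_product)
  also have "\<dots> = (\<Sum>m\<in>exponents n. coeff3 f m * (\<Prod>i\<in>UNIV. v $ i ^ m i))"
  proof (rule sum.reindex_bij_witness[of _ "\<lambda>m. (m 3, m 2, m 1)" "\<lambda>(i, j, k). mk k j i"], goal_cases)
    case (1 a) then show ?case by (auto simp: mk)
  next
    case (2 a) then show ?case by (auto simp: exponents_def mk forall_3)
  next
    case (3 b) then show ?case by (simp add: fun_eq_iff forall_3 mk)
  next
    case (4 b) then show ?case by (auto simp: exponents_def)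
  next
    case (5 a) show ?case by (cases a) (simp add: coeff3_def mk prod_3)
  qed
  finally show ?thesis .
qed

lemma homogeneous3_exponents:
  assumes "homogeneous3 d f" "coeff3 f m \<noteq> 0"
  shows "m \<in> exponents d"
proof -
  have "(\<Sum>i\<in>UNIV. m i) = d" using assms unfolding homogeneous3_def by blast
  then show ?thesis unfolding exponents_def by (auto simp: sum_3 forall_3)
qed

lemma eval3_homogeneous:
  fixes f :: "'a::comm_ring_1 poly3"
  assumes "homogeneous3 d f"
  shows "eval3 f v = (\<Sum>m\<in>exponents d. coeff3 f m * (\<Prod>i\<in>UNIV. v $ i ^ m i))"
  using homogeneous3_exponents[OF assms] by (rule eval3_eq_sum)

lemma eval3_scale:
  fixes f :: "'a::comm_ring_1 poly3"
  assumes f: "homogeneous3 d f"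
  shows "eval3 f (c *s v) = c ^ d * eval3 f v"
proof -
  have "coeff3 f m * (\<Prod>i\<in>UNIV. (c *s v) $ i ^ m i) = c ^ d * (coeff3 f m * (\<Prod>i\<in>UNIV. v $ i ^ m i))" for m
  proof (cases "coeff3 f m = 0")
    case False
    then have "(\<Sum>i\<in>UNIV. m i) = d" using f unfolding homogeneous3_def by blast
    then show ?thesis
      by (auto simp: power_mult_distrib prod.distrib power_sum[symmetric])
  qed simp
  then show ?thesis by (simp add: eval3_homogeneous[OF f] sum_distrib_left)
qed

definition permute_coords :: "(3 \<Rightarrow> 3) \<Rightarrow> 'a ^ 3 \<Rightarrow> 'a ^ 3" where
  "permute_coords \<pi> v = (\<chi> i. v $ \<pi> i)"

lemma permute_coords_nth [simp]: "permute_coords \<pi> v $ i = v $ \<pi> i"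
  by (simp add: permute_coords_def)

text \<open>The monomial with exponents \<open>m \<circ> \<pi>\<close> at the permuted vector equals
  the monomial with exponents \<open>m\<close> at \<open>v\<close>, so reindexing the sum by
  \<open>m \<circ> \<pi>\<close> suffices.\<close>

lemma eval3_permute_coords:
  fixes f :: "'a::comm_ring_1 poly3"
  assumes f: "homogeneous3 d f" and sym: "symmetric3 f" and \<pi>: "bij \<pi>"
  shows "eval3 f (permute_coords \<pi> v) = eval3 f v"
proof -
  have "eval3 f v = (\<Sum>m\<in>exponents d. coeff3 f m * (\<Prod>i\<in>UNIV. v $ i ^ m i))"
    by (rule eval3_homogeneous[OF f])
  also have "\<dots> = (\<Sum>m\<in>exponents d. coeff3 f m * (\<Prod>i\<in>UNIV. permute_coords \<pi> v $ i ^ m i))"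
  proof (rule sum.reindex_bij_witness[of _ "\<lambda>m. m \<circ> inv_into UNIV \<pi>" "\<lambda>m. m \<circ> \<pi>"])
    fix m
    have "(\<Prod>i\<in>UNIV. v $ \<pi> i ^ m (\<pi> i)) = (\<Prod>i\<in>UNIV. v $ i ^ m i)"
      by (rule prod.reindex_bij_betw[OF \<pi>])
    then show "coeff3 f (m \<circ> \<pi>) * (\<Prod>i\<in>UNIV. permute_coords \<pi> v $ i ^ (m \<circ> \<pi>) i)
        = coeff3 f m * (\<Prod>i\<in>UNIV. v $ i ^ m i)"
      using sym \<pi> unfolding symmetric3_def by simp
  qed (use \<pi> in \<open>auto simp: exponents_def fun_eq_iff bij_is_surj surj_f_inv_f bij_is_inj\<close>)
  also have "\<dots> = eval3 f (permute_coords \<pi> v)"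
    by (rule eval3_homogeneous[OF f, symmetric])
  finally show ?thesis by simp
qed

lemma coeff3_complexify: "coeff3 (complexify f) m = complex_of_real (coeff3 f m)"
  by (simp add: coeff3_def complexify_def coeff_map_poly map_poly_0)

lemma homogeneous3_complexify: "homogeneous3 d f \<Longrightarrow> homogeneous3 d (complexify f)"
  by (simp add: homogeneous3_def coeff3_complexify)

lemma symmetric3_complexify: "symmetric3 f \<Longrightarrow> symmetric3 (complexify f)"
  by (simp add: symmetric3_def coeff3_complexify)

lemma eval3_add: "eval3 (a + b) v = eval3 a v + eval3 b v"
  and eval3_diff: "eval3 (a - b) v = eval3 a v - eval3 b v"
  and eval3_mult: "eval3 (a * b) v = eval3 a v * eval3 b v"
  and eval3_0: "eval3 0 v = 0"
  and eval3_1: "eval3 1 v = 1"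
  and eval3_const: "eval3 [:[:[:c:]:]:] v = c"
  by (simp_all add: eval3_def)

lemma eval3_pCons: "eval3 (pCons a p) v = poly (poly a [:v $ 2:]) (v $ 1) + v $ 3 * eval3 p v"
  by (simp add: eval3_def)

section \<open>Derivatives along lines\<close>

lemma poly_line_deriv:
  fixes q :: "complex poly"
  shows "((\<lambda>t. poly q (x + t * a)) has_field_derivative poly (pderiv q) x * a) (at 0)"
  by (rule DERIV_chain'[where f = "\<lambda>t. x + t * a" and g = "poly q"])
     (auto intro!: derivative_eq_intros poly_DERIV[THEN DERIV_cong])

lemma poly_poly_line_deriv:
  fixes p :: "complex poly poly"
  shows "\<exists>\<alpha> \<beta>. \<forall>a b. ((\<lambda>t. poly (poly p [:z + t * b:]) (x + t * a)) has_field_derivative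
    \<alpha> * a + \<beta> * b) (at 0)"
proof (induction p)
  case 0
  show ?case by (intro exI[of _ 0]) simp
next
  case (pCons q p)
  obtain \<alpha> \<beta> where IH: "((\<lambda>t. poly (poly p [:z + t * b:]) (x + t * a)) has_field_derivative
    \<alpha> * a + \<beta> * b) (at 0)" for a b using pCons.IH by blast
  have "((\<lambda>t. poly (poly (pCons q p) [:z + t * b:]) (x + t * a)) has_field_derivative
      (poly (pderiv q) x + z * \<alpha>) * a + (poly (poly p [:z:]) x + z * \<beta>) * b) (at 0)" for a b
    by (auto intro!: derivative_eq_intros IH poly_line_deriv simp: algebra_simps)
  then show ?case by blast
qed

text \<open>\<open>\<alpha>\<close> is the gradient of f at v. Later arguments need only that the
  derivative is linear in the direction w, so the gradient is kept existential and built up by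
  induction on the polynomial in Z.\<close>

lemma eval3_line_deriv:
  fixes f :: "complex poly3"
  shows "\<exists>\<alpha>. \<forall>w. ((\<lambda>t. eval3 f (v + t *s w)) has_field_derivative (\<Sum>i\<in>UNIV. \<alpha> i * w $ i)) (at 0)"
proof (induction f)
  case 0
  show ?case by (intro exI[of _ "\<lambda>_. 0"]) (simp add: eval3_0)
next
  case (pCons q p)
  obtain \<gamma> where IH: "((\<lambda>t. eval3 p (v + t *s w)) has_field_derivative (\<Sum>i\<in>UNIV. \<gamma> i * w $ i)) (at 0)" for w
    using pCons.IH by blast
  obtain \<alpha> \<beta> where q: "((\<lambda>t. poly (poly q [:v $ 2 + t * b:]) (v $ 1 + t * a)) has_field_derivative
    \<alpha> * a + \<beta> * b) (at 0)" for a b using poly_poly_line_deriv by blast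
  \<comment> \<open>Product rule for q + Z p: the derivative in Z gains the extra term p(v).\<close>
  define \<delta> where "\<delta> i = v $ 3 * \<gamma> i + (if i = 1 then \<alpha> else if i = 2 then \<beta> else eval3 p v)" for i
  have "((\<lambda>t. eval3 (pCons q p) (v + t *s w)) has_field_derivative (\<Sum>i\<in>UNIV. \<delta> i * w $ i)) (at 0)" for w
    unfolding eval3_pCons
    by (auto intro!: derivative_eq_intros IH q simp: sum_3 \<delta>_def algebra_simps)
  then show ?case by blast
qed

section \<open>Transversality and common tangents\<close>

text \<open>Vanishing to second order at t = 0 along the line v + t w. At a singular zero every w
  qualifies, and at a zero of a form every multiple of v does.\<close>

definition tangent :: "complex poly3 \<Rightarrow> complex ^ 3 \<Rightarrow> complex ^ 3 \<Rightarrow> bool" where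
  "tangent f v w \<longleftrightarrow> eval3 f v = 0 \<and> ((\<lambda>t. eval3 f (v + t *s w)) has_field_derivative 0) (at 0)"

lemma eval3_line_differentiable:
  obtains D where "((\<lambda>t. eval3 f (v + t *s w)) has_field_derivative D) (at (0::complex))"
  using eval3_line_deriv by blast

text \<open>Together with \<open>tangent_mult\<close>: for fixed v and w these polynomials form an
  ideal, so it contains (f, g) once it contains f and g.\<close>

lemma tangent_add: "tangent f v w \<Longrightarrow> tangent g v w \<Longrightarrow> tangent (f + g) v w"
  unfolding tangent_def eval3_add by (auto intro!: derivative_eq_intros)

lemma tangent_mult:
  assumes "tangent f v w"
  shows "tangent (r * f) v w"
proof -
  obtain D where "((\<lambda>t. eval3 r (v + t *s w)) has_field_derivative D) (at 0)"
    by (rule eval3_line_differentiable)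
  then show ?thesis using assms
    unfolding tangent_def eval3_mult by (auto intro!: derivative_eq_intros)
qed

text \<open>Restricted to the line, g is a unit modulo t^2, since g(v) is nonzero.\<close>

lemma tangent_cancel:
  assumes fg: "tangent (f * g) v w" and g: "eval3 g v \<noteq> 0"
  shows "tangent f v w"
proof -
  obtain D where D: "((\<lambda>t. eval3 f (v + t *s w)) has_field_derivative D) (at 0)"
    by (rule eval3_line_differentiable)
  obtain E where E: "((\<lambda>t. eval3 g (v + t *s w)) has_field_derivative E) (at 0)"
    by (rule eval3_line_differentiable)
  have f: "eval3 f v = 0" using fg g unfolding tangent_def eval3_mult by auto
  have "((\<lambda>t. eval3 (f * g) (v + t *s w)) has_field_derivative D * eval3 g v) (at 0)"
    unfolding eval3_mult using D E f by (auto intro!: derivative_eq_intros)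
  then have "D * eval3 g v = 0" using fg DERIV_unique unfolding tangent_def by blast
  then show ?thesis using D f g unfolding tangent_def by auto
qed

section \<open>Linear forms, projective points and elements of the local ring\<close>

definition linear_form :: "'a::comm_ring_1 ^ 3 \<Rightarrow> 'a poly3" where
  "linear_form a = [:[:[:0, a $ 1:], [:a $ 2:]:], [:[:a $ 3:]:]:]"

lemma eval3_linear_form: "eval3 (linear_form a) v = (\<Sum>i\<in>UNIV. a $ i * v $ i)"
  by (simp add: linear_form_def eval3_def sum_3 mult.commute)

lemma sum_axis: "(\<Sum>i\<in>UNIV. axis k 1 $ i * u $ i) = (u $ k :: 'a::comm_ring_1)"
  by (simp add: axis_def if_distrib[of "\<lambda>a. a * _"] cong: if_cong)

lemma homogeneous3_linear_form: "homogeneous3 1 (linear_form a)"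
  unfolding homogeneous3_def
proof (intro allI impI)
  fix m assume "coeff3 (linear_form a) m \<noteq> 0"
  then show "(\<Sum>i\<in>UNIV. m i) = 1"
    unfolding coeff3_def linear_form_def sum_3
    by (auto simp: coeff_pCons split: nat.splits)
qed

lemma homogeneous3_1: "homogeneous3 0 (1 :: 'a::comm_ring_1 poly3)"
  unfolding homogeneous3_def coeff3_def by (auto simp: sum_3 coeff_1 split: if_splits)

definition homogeneous_line :: "complex ^ 3 \<Rightarrow> point" where
  "homogeneous_line v = {c *s v | c. c \<noteq> 0}"

lemma homogeneous_line_self: "v \<in> homogeneous_line v"
  unfolding homogeneous_line_def by (auto intro: exI[of _ 1])

lemma proj_plane_eq: "proj_plane = homogeneous_line ` (UNIV - {0})"
  unfolding proj_plane_def quotient_def homogeneous_line_def by auto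

lemma scale_of_minors_eq_0:
  fixes v w :: "complex ^ 3"
  assumes k: "v $ k \<noteq> 0" and "\<And>j. v $ k * w $ j = v $ j * w $ k"
  shows "\<exists>c. w = c *s v"
proof (intro exI)
  show "w = (w $ k / v $ k) *s v"
    using assms by (simp add: Finite_Cartesian_Product.vec_eq_iff field_simps)
qed

lemma local_ring_Fract:
  assumes "homogeneous3 n a" "homogeneous3 n b" "\<forall>v\<in>p. eval3 b v \<noteq> 0"
  shows "Fract a b \<in> local_ring p"
  using assms unfolding local_ring_def by blast

lemma Fract_diff_eqD:
  fixes k :: "'a::idom"
  assumes "a2 \<noteq> 0" "b2 \<noteq> 0" "q2 \<noteq> 0" and "Fract q1 q2 - Fract k 1 * Fract b1 b2 = Fract a1 a2"
  shows "(q1 * b2 - k * b1 * q2) * a2 = q2 * b2 * a1"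
  using assms by (simp add: eq_fract mult.commute)

text \<open>Multiplicity 1 gives a single b spanning the quotient. Testing it on 1 shows b(v) to be
  nonzero; testing it on L/M, with L a linear form vanishing at v but not at w, then gives the
  coefficient 0 and makes L tangent along w, a contradiction. Denominators are cleared first, so
  that only polynomials are differentiated.\<close>

lemma intersection_multiplicity_1_tangent:
  assumes mult: "intersection_multiplicity f g p = 1" and p: "p = homogeneous_line v" and v: "v \<noteq> 0"
    and f: "tangent (complexify f) v w" and g: "tangent (complexify g) v w"
  shows "\<exists>c. w = c *s v"
proof (rule ccontr)
  assume not_parallel: "\<not> ?thesis"
  let ?const = "\<lambda>c. [:[:[:c:]:]:] :: complex poly3"
  let ?I = "local_ideal (complexify f) (complexify g) p"
  have vp: "v \<in> p" unfolding p by (rule homogeneous_line_self)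
  obtain k where k: "v $ k \<noteq> 0" using v by (auto simp: Finite_Cartesian_Product.vec_eq_iff)
  obtain j where j: "v $ k * w $ j \<noteq> v $ j * w $ k"
    using scale_of_minors_eq_0[OF k] not_parallel by blast
  \<comment> \<open>L vanishes at v and takes at w the nonzero minor just found; M is a coordinate
    that does not vanish at v.\<close>
  define L where "L = linear_form (v $ k *s axis j 1 - v $ j *s axis k 1)"
  define M where "M = linear_form (axis k (1::complex))"
  have L_eval: "eval3 L u = v $ k * u $ j - v $ j * u $ k" for u
    unfolding L_def eval3_linear_form
    by (simp add: left_diff_distrib sum_subtractf mult.assoc sum_axis flip: sum_distrib_left)
  have M_eval: "eval3 M u = u $ k" for u
    unfolding M_def eval3_linear_form by (rule sum_axis)
  obtain b where b: "b \<in> local_ring p"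
    and span: "\<And>q. q \<in> local_ring p \<Longrightarrow> \<exists>c. q - Fract (?const c) 1 * b \<in> ?I"
  proof -
    let ?\<B> = "{B. finite B \<and> B \<subseteq> local_ring p \<and> (\<forall>q\<in>local_ring p. \<exists>c :: complex poly3 fract \<Rightarrow> complex.
            q - (\<Sum>b\<in>B. Fract (?const (c b)) 1 * b) \<in> ?I)}"
    have "(INF B\<in>?\<B>. enat (card B)) < enat 2"
      using mult unfolding intersection_multiplicity_def by (simp add: one_enat_def)
    then obtain B where B: "B \<in> ?\<B>" and "enat (card B) < enat 2"
      unfolding INF_less_iff by blast
    then have "card B < 2" by simp
    then have "card B = 0 \<or> card B = 1" by linarith
    then show ?thesis
    proof
      \<comment> \<open>The quotient is zero here; the element 1, always with coefficient 0, serves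
        as b.\<close>
      assume "card B = 0"
      then have "B = {}" using B by auto
      have one: "Fract 1 1 \<in> local_ring p"
        by (rule local_ring_Fract[OF homogeneous3_1 homogeneous3_1]) (simp add: eval3_1)
      show ?thesis
      proof (rule that[OF one])
        fix q assume "q \<in> local_ring p"
        then have "q \<in> ?I" using B \<open>B = {}\<close> by auto
        moreover have "Fract (?const 0) 1 = 0" by (simp add: Zero_fract_def)
        ultimately show "\<exists>c. q - Fract (?const c) 1 * Fract 1 1 \<in> ?I"
          by (intro exI[of _ 0]) simp
      qed
    next
      assume "card B = 1"
      then obtain b where "B = {b}" using card_1_singletonE by blast
      then show ?thesis using B by (intro that[of b]) (simp_all del: mult_pCons_left, blast)
    qed
  qed
  obtain b1 b2 where b12: "b = Fract b1 b2" and b2: "eval3 b2 v \<noteq> 0"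
    using b vp unfolding local_ring_def by blast
  \<comment> \<open>The numerator of q - c b is tangent: after multiplication by \<open>a2\<close>,
    nonzero at v, it becomes a multiple of an element of the ideal (f, g).\<close>
  have key: "\<exists>c. tangent (q1 * b2 - ?const c * b1 * q2) v w"
    if q: "Fract q1 q2 \<in> local_ring p" and q2: "eval3 q2 v \<noteq> 0" for q1 q2
  proof -
    obtain c where "Fract q1 q2 - Fract (?const c) 1 * b \<in> ?I" using span[OF q] by blast
    then obtain a1 a2 r s where eq: "Fract q1 q2 - Fract (?const c) 1 * b = Fract a1 a2"
      and a1: "a1 = r * complexify f + s * complexify g" and a2: "eval3 a2 v \<noteq> 0"
      using vp unfolding local_ideal_def by blast
    have nz: "a2 \<noteq> 0" "b2 \<noteq> 0" "q2 \<noteq> 0" using a2 b2 q2 by (auto simp: eval3_0)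
    then have "(q1 * b2 - ?const c * b1 * q2) * a2 = q2 * b2 * a1"
      using eq unfolding b12 by (intro Fract_diff_eqD)
    moreover have "tangent a1 v w" unfolding a1 by (intro tangent_add tangent_mult f g)
    then have "tangent (q2 * b2 * a1) v w" by (rule tangent_mult)
    ultimately have "tangent ((q1 * b2 - ?const c * b1 * q2) * a2) v w" by (simp only:)
    then show ?thesis using tangent_cancel a2 by blast
  qed
  have b1: "eval3 b1 v \<noteq> 0"
  proof -
    have "Fract 1 1 \<in> local_ring p"
      by (rule local_ring_Fract[OF homogeneous3_1 homogeneous3_1]) (simp add: eval3_1)
    from key[OF this] obtain c where "tangent (1 * b2 - ?const c * b1 * 1) v w" by (auto simp: eval3_1)
    then have "eval3 b2 v = c * eval3 b1 v"
      unfolding tangent_def by (simp add: eval3_diff eval3_mult eval3_const del: mult_pCons_left)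
    then show ?thesis using b2 by auto
  qed
  have M: "\<forall>u\<in>p. eval3 M u \<noteq> 0" unfolding M_eval p homogeneous_line_def using k by auto
  have "Fract L M \<in> local_ring p"
    unfolding L_def M_def
    by (rule local_ring_Fract[OF homogeneous3_linear_form homogeneous3_linear_form]) (use M in \<open>simp add: M_def\<close>)
  from key[OF this] obtain c where c: "tangent (L * b2 - ?const c * b1 * M) v w" using M vp by blast
  have L0: "eval3 L v = 0" unfolding L_eval by simp
  \<comment> \<open>The value at v, where L vanishes, isolates c.\<close>
  have "c * eval3 b1 v * eval3 M v = 0"
    using c L0 unfolding tangent_def by (simp add: eval3_diff eval3_mult eval3_const del: mult_pCons_left)
  then have "c = 0" using b1 M vp by auto
  then have "tangent (L * b2) v w" using c by simp
  then have "tangent L v w" using b2 by (rule tangent_cancel)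
  moreover have "((\<lambda>t. eval3 L (v + t *s w)) has_field_derivative v $ k * w $ j - v $ j * w $ k) (at 0)"
    unfolding L_eval by (auto intro!: derivative_eq_intros simp: algebra_simps)
  ultimately have "0 = v $ k * w $ j - v $ j * w $ k"
    unfolding tangent_def using DERIV_unique by blast
  then show False using j by simp
qed

section \<open>A weak form of Bezout's theorem\<close>

text \<open>Each coordinate of \<open>x *s A + B + z *s C\<close> has total degree at most 1 in x
  and z, so a monomial of degree d becomes a polynomial of total degree at most d.\<close>

lemma affine_chart:
  fixes f :: "complex poly3"
  assumes f: "homogeneous3 d f"
  obtains F where "total_degree_le d F"
    "\<And>x z. poly (poly F [:z:]) x = eval3 f (x *s A + B + z *s C)"
proof -
  define l where "l i = [:[:B $ i, A $ i:], [:C $ i:]:]" for i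
  define F where "F = (\<Sum>m\<in>exponents d. [:[:coeff3 f m:]:] * (\<Prod>i\<in>UNIV. l i ^ m i))"
  show ?thesis
  proof (rule that)
    show "total_degree_le d F" unfolding F_def
    proof (rule total_degree_le_sum)
      fix m
      show "total_degree_le d ([:[:coeff3 f m:]:] * (\<Prod>i\<in>UNIV. l i ^ m i))"
      proof (cases "coeff3 f m = 0")
        case False
        then have d: "d = 0 + (m 1 + m 2 + m 3)"
          using f unfolding homogeneous3_def by (simp add: sum_3)
        have l: "total_degree_le 1 (l i)" for i unfolding l_def by (rule total_degree_le_linear)
        show ?thesis unfolding d prod_3
          by (intro total_degree_le_mult total_degree_le_const total_degree_le_power l)
      qed (simp add: total_degree_le_0)
    qed
    fix x z
    have "poly (poly (l i) [:z:]) x = (x *s A + B + z *s C) $ i" for i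
      unfolding l_def by simp
    then show "poly (poly F [:z:]) x = eval3 f (x *s A + B + z *s C)"
      unfolding F_def eval3_homogeneous[OF f] by (simp add: poly_sum poly_prod prod_3)
  qed
qed

section \<open>Common factors in a chart and common tangents\<close>

lemma poly_poly_eq: "poly (poly h [:z:]) x = poly (map_poly (\<lambda>c. poly c x) h) z"
  by (induction h) (simp_all add: map_poly_pCons)

text \<open>Fix x where the leading coefficient in z does not vanish; the remaining polynomial in z
  is nonconstant and has a root.\<close>

lemma bivariate_zero:
  fixes h :: "complex poly poly"
  assumes "degree h > 0"
  obtains x z where "poly (poly h [:z:]) x = 0"
proof -
  have "lead_coeff h \<noteq> 0" using assms by auto
  then obtain x where x: "poly (lead_coeff h) x \<noteq> 0" using poly_all_0_iff_0 by blast
  then have "degree (map_poly (\<lambda>c. poly c x) h) = degree h" by (intro map_poly_degree_eq)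
  then have "\<not> constant (poly (map_poly (\<lambda>c. poly c x) h))" using assms by (simp add: constant_degree)
  then obtain z where "poly (map_poly (\<lambda>c. poly c x) h) z = 0"
    using fundamental_theorem_of_algebra by blast
  then show ?thesis using that poly_poly_eq by metis
qed

text \<open>For two forms this says that the gradients are linearly independent at every common zero
  v: both gradients annihilate v, so rank 2 leaves exactly its multiples.\<close>

definition no_common_tangent :: "complex poly3 \<Rightarrow> complex poly3 \<Rightarrow> bool" where
  "no_common_tangent f g \<longleftrightarrow>
    (\<forall>v w. v \<noteq> 0 \<longrightarrow> tangent f v w \<longrightarrow> tangent g v w \<longrightarrow> (\<exists>c. w = c *s v))"

lemma homogeneous_eq_nontrivial_solution:
  fixes \<alpha> \<beta> :: "'a::field"
  obtains a b where "\<alpha> * a + \<beta> * b = 0" "a \<noteq> 0 \<or> b \<noteq> 0"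
proof (cases "\<beta> = 0")
  case True
  then show ?thesis using that[of 0 1] by simp
next
  case False
  then show ?thesis using that[of \<beta> "- \<alpha>"] by simp
qed

text \<open>In the chart f is h q, so second-order vanishing of h along (a, b) carries over to f;
  this chart direction is \<open>a *s A + b *s C\<close> in space.\<close>

lemma tangent_of_chart_factor:
  fixes F h :: "complex poly poly"
  assumes chart: "\<And>x z. poly (poly F [:z:]) x = eval3 f (x *s A + B + z *s C)"
    and "h dvd F" and zero: "poly (poly h [:z:]) x = 0"
    and deriv: "((\<lambda>t. poly (poly h [:z + t * b:]) (x + t * a)) has_field_derivative 0) (at 0)"
  shows "tangent f (x *s A + B + z *s C) (a *s A + b *s C)"
proof -
  obtain q where F: "F = h * q" using \<open>h dvd F\<close> by blast
  have line: "eval3 f ((x *s A + B + z *s C) + t *s (a *s A + b *s C)) =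
      poly (poly h [:z + t * b:]) (x + t * a) * poly (poly q [:z + t * b:]) (x + t * a)" for t
  proof -
    have "(x *s A + B + z *s C) + t *s (a *s A + b *s C) = (x + t * a) *s A + B + (z + t * b) *s C"
      by (simp add: Finite_Cartesian_Product.vec_eq_iff algebra_simps)
    then show ?thesis by (simp only: chart[symmetric] F poly_mult)
  qed
  obtain D where "((\<lambda>t. poly (poly q [:z + t * b:]) (x + t * a)) has_field_derivative D) (at 0)"
    using poly_poly_line_deriv by blast
  moreover have "eval3 f (x *s A + B + z *s C) = 0"
    by (simp add: chart[symmetric] F zero)
  ultimately show ?thesis using zero deriv
    unfolding tangent_def line by (auto intro!: derivative_eq_intros)
qed

lemma avoid_roots:
  fixes P :: "complex poly set"
  assumes "finite P" "0 \<notin> P"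
  shows "\<exists>s. \<forall>p\<in>P. poly p s \<noteq> 0"
proof -
  have "finite (\<Union>p\<in>P. {s. poly p s = 0})"
    using assms by (intro finite_UN_I poly_roots_finite) auto
  then obtain s where "s \<notin> (\<Union>p\<in>P. {s. poly p s = 0})"
    using ex_new_if_finite[OF infinite_UNIV_char_0] by blast
  then show ?thesis by blast
qed

text \<open>
  The linear forms used as coordinates are the values at two generic points \<open>s, s'\<close> of the
  polynomials whose coefficients are the homogeneous coordinates; projecting along
  \<open>(t - s) (t - s')\<close> separates any finite set of points.
\<close>

lemma card_common_zeros_le:
  fixes f g :: "complex poly3"
  assumes f: "homogeneous3 d f" and g: "homogeneous3 e g" and e: "e \<ge> 1"
    and ntan: "no_common_tangent f g"
    and fin: "finite P" and zeros: "\<And>v. v \<in> P \<Longrightarrow> v \<noteq> 0 \<and> eval3 f v = 0 \<and> eval3 g v = 0"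
    and distinct: "\<And>u v c. u \<in> P \<Longrightarrow> v \<in> P \<Longrightarrow> u \<noteq> v \<Longrightarrow> v \<noteq> c *s u"
  shows "card P \<le> d * e"
proof (cases "P = {}")
  case True
  then show ?thesis by simp
next
  case False
  define Q :: "complex ^ 3 \<Rightarrow> complex poly" where "Q v = [:v $ 1, v $ 2, v $ 3:]" for v
  have Q_eq_0: "Q v = 0 \<longleftrightarrow> v = 0" for v
    unfolding Q_def by (simp add: Finite_Cartesian_Product.vec_eq_iff forall_3)
  have Q_scale: "poly (Q (a *s u)) t = a * poly (Q u) t"
    and Q_add: "poly (Q (u + v)) t = poly (Q u) t + poly (Q v) t"
    and Q_diff: "poly (Q (u - v)) t = poly (Q u) t - poly (Q v) t" for a u v t
    unfolding Q_def by (simp_all add: algebra_simps)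
  have "0 \<notin> Q ` P" using zeros Q_eq_0 by auto
  then obtain s where s: "\<And>v. v \<in> P \<Longrightarrow> poly (Q v) s \<noteq> 0"
    using avoid_roots[OF finite_imageI[OF fin], of Q] by (metis imageI)
  \<comment> \<open>The combination of u and v whose polynomial vanishes at s. It is nonzero for
    distinct points, and its value at s' measures the difference of their first chart
    coordinates.\<close>
  define diff where "diff u v = poly (Q v) s *s u - poly (Q u) s *s v" for u v
  have diff: "diff u v \<noteq> 0" if "u \<in> P" "v \<in> P" "u \<noteq> v" for u v
  proof
    assume "diff u v = 0"
    then have "v = (poly (Q v) s / poly (Q u) s) *s u"
      using s[OF \<open>u \<in> P\<close>] unfolding diff_def
      by (auto simp: Finite_Cartesian_Product.vec_eq_iff field_simps)
    then show False using distinct that by blast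
  qed
  \<comment> \<open>The extra polynomial t - s forces s' to differ from s.\<close>
  define PP where "PP = insert [:- s, 1:] ((\<lambda>(u, v). Q (diff u v)) ` {(u, v). u \<in> P \<and> v \<in> P \<and> u \<noteq> v})"
  have "finite {(u, v). u \<in> P \<and> v \<in> P \<and> u \<noteq> v}"
    by (rule finite_subset[of _ "P \<times> P"]) (use fin in auto)
  then have "finite PP" unfolding PP_def by simp
  moreover have "0 \<notin> PP" using diff Q_eq_0 unfolding PP_def by fastforce
  ultimately obtain s' where s': "\<And>p. p \<in> PP \<Longrightarrow> poly p s' \<noteq> 0" using avoid_roots[of PP] by (metis (no_types))
  have ss': "s - s' \<noteq> 0" using s'[of "[:- s, 1:]"] unfolding PP_def by simp
  have sep: "poly (Q (diff u v)) s' \<noteq> 0" if "u \<in> P" "v \<in> P" "u \<noteq> v" for u v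
    using s' that unfolding PP_def by blast
  \<comment> \<open>The coefficient vectors of -(t - s), t - s' and (t - s)(t - s'). Up to the
    factor s - s', the coordinates of v along A and B are the values of its polynomial at s' and
    s.\<close>
  define A B C :: "complex ^ 3"
    where "A = vector [s, - 1, 0]"
      and "B = vector [- s', 1, 0]"
      and "C = vector [s * s', - (s + s'), 1]"
  have coords: "poly (Q A) s = 0" "poly (Q A) s' = s - s'" "poly (Q B) s = s - s'" "poly (Q B) s' = 0"
    "poly (Q C) s = 0" "poly (Q C) s' = 0" "A $ 3 = 0" "B $ 3 = 0" "C $ 3 = 1"
    unfolding A_def B_def C_def Q_def by (simp_all add: algebra_simps)
  have decompose: "(s - s') *s v = poly (Q v) s' *s A + poly (Q v) s *s B + ((s - s') * v $ 3) *s C" for v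
    unfolding A_def B_def C_def Q_def Finite_Cartesian_Product.vec_eq_iff forall_3
    by (simp add: algebra_simps)
  obtain F where F: "total_degree_le d F"
    and F_eval: "\<And>x z. poly (poly F [:z:]) x = eval3 f (x *s A + B + z *s C)"
    using affine_chart[OF f] by blast
  obtain G where G: "total_degree_le e G"
    and G_eval: "\<And>x z. poly (poly G [:z:]) x = eval3 g (x *s A + B + z *s C)"
    using affine_chart[OF g] by blast
  \<comment> \<open>A direction (a, b) killed by the derivative of h would be tangent to both forms.
    It is not a multiple of v, since the polynomial of w vanishes at s and that of v does
    not.\<close>
  have no_factor: "poly (poly h [:z:]) x \<noteq> 0" if h: "h dvd F" "h dvd G" for h x z
  proof
    assume zero: "poly (poly h [:z:]) x = 0"
    obtain \<alpha> \<beta> where deriv: "((\<lambda>t. poly (poly h [:z + t * b:]) (x + t * a)) has_field_derivative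
        \<alpha> * a + \<beta> * b) (at 0)" for a b using poly_poly_line_deriv by blast
    obtain a b where ab: "\<alpha> * a + \<beta> * b = 0" "a \<noteq> 0 \<or> b \<noteq> 0"
      by (rule homogeneous_eq_nontrivial_solution)
    define v w where "v = x *s A + B + z *s C" and "w = a *s A + b *s C"
    have v: "poly (Q v) s = s - s'" and w: "poly (Q w) s = 0" "poly (Q w) s' = a * (s - s')" "w $ 3 = b"
      unfolding v_def w_def by (simp_all add: Q_add Q_scale coords)
    have deriv0: "((\<lambda>t. poly (poly h [:z + t * b:]) (x + t * a)) has_field_derivative 0) (at 0)"
      using deriv[of b a] ab(1) by simp
    have "tangent f v w" "tangent g v w"
      unfolding v_def w_def
      by (rule tangent_of_chart_factor[OF F_eval h(1) zero deriv0]
          tangent_of_chart_factor[OF G_eval h(2) zero deriv0])+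
    moreover have "v \<noteq> 0" using v ss' Q_eq_0[of v] by auto
    ultimately obtain c where c: "w = c *s v" using ntan unfolding no_common_tangent_def by blast
    then have "c * (s - s') = 0" using v w(1) Q_scale[of c v s] by simp
    then have "c = 0" using ss' by simp
    then have "w = 0" using c by simp
    then show False using ab(2) w ss' Q_eq_0[of w] by auto
  qed
  \<comment> \<open>Chart coordinates of v, obtained by scaling its B-component to 1.\<close>
  define x where "x v = poly (Q v) s' / poly (Q v) s" for v
  define z where "z v = (s - s') * v $ 3 / poly (Q v) s" for v
  have normalize: "x v *s A + B + z v *s C = ((s - s') / poly (Q v) s) *s v" if "v \<in> P" for v
  proof -
    have "((s - s') / poly (Q v) s) *s v = (1 / poly (Q v) s) *s ((s - s') *s v)"
      by (simp only: vector_smult_assoc) simp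
    also have "\<dots> = x v *s A + B + z v *s C"
      unfolding decompose[of v] using s[OF that]
      by (simp add: x_def z_def Finite_Cartesian_Product.vec_eq_iff add_divide_distrib)
    finally show ?thesis by simp
  qed
  have zero: "poly (poly F [:z v:]) (x v) = 0" "poly (poly G [:z v:]) (x v) = 0" if "v \<in> P" for v
    unfolding F_eval G_eval normalize[OF that] eval3_scale[OF f] eval3_scale[OF g]
    using zeros[OF that] by simp_all
  have "degree (gcd F G) = 0"
    using no_factor[of "gcd F G"] bivariate_zero[of "gcd F G"] by blast
  \<comment> \<open>If \<open>F\<close> were 0, then \<open>G\<close> would be a common divisor with
    a zero at any point of P.\<close>
  moreover have "F \<noteq> 0" using no_factor[of G] zero False by fastforce
  ultimately have bound: "finite {x. \<exists>z. poly (poly F [:z:]) x = 0 \<and> poly (poly G [:z:]) x = 0}"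
    "card {x. \<exists>z. poly (poly F [:z:]) x = 0 \<and> poly (poly G [:z:]) x = 0} \<le> d * e"
    using card_common_abscissae_le[OF F G _ e] by blast+
  have "inj_on x P"
  proof (rule inj_onI, rule ccontr)
    fix u v assume uv: "u \<in> P" "v \<in> P" "x u = x v" "u \<noteq> v"
    then have "poly (Q (diff u v)) s' = 0"
      using s[of u] s[of v] unfolding diff_def x_def Q_diff Q_scale by (simp add: field_simps)
    then show False using sep uv by blast
  qed
  then have "card P = card (x ` P)" by (simp add: card_image)
  also have "\<dots> \<le> card {x. \<exists>z. poly (poly F [:z:]) x = 0 \<and> poly (poly G [:z:]) x = 0}"
    by (rule card_mono[OF bound(1)]) (use zero in blast)
  finally show ?thesis using bound(2) by simp
qed

section \<open>Points with a nontrivial stabiliser\<close>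

text \<open>The derivative at 0 of an even function equals its own negative.\<close>

lemma tangent_of_even:
  assumes zero: "eval3 f v = 0" and even: "\<And>t. eval3 f (v + (- t) *s w) = eval3 f (v + t *s w)"
  shows "tangent f v w"
proof -
  obtain D where D: "((\<lambda>t. eval3 f (v + t *s w)) has_field_derivative D) (at 0)"
    by (rule eval3_line_differentiable)
  have "((\<lambda>t. eval3 f (v + (- t) *s w)) has_field_derivative D * - 1) (at 0)"
    by (rule DERIV_chain2[where f = "\<lambda>t. eval3 f (v + t *s w)" and g = uminus])
       (use D in \<open>auto intro!: derivative_eq_intros\<close>)
  then have "D = D * - 1" unfolding even using D DERIV_unique by blast
  then show ?thesis using D zero unfolding tangent_def by simp
qed

lemma obtain_third:
  fixes i j :: 3
  assumes "i \<noteq> j"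
  obtains k where "k \<noteq> i" "k \<noteq> j" "\<And>l. l = i \<or> l = j \<or> l = k"
proof -
  have ex: "(\<exists>k. P k) \<longleftrightarrow> P 1 \<or> P 2 \<or> P 3" for P :: "3 \<Rightarrow> bool"
    using exhaust_3 by metis
  have "\<exists>k. k \<noteq> i \<and> k \<noteq> j \<and> (\<forall>l. l = i \<or> l = j \<or> l = k)"
    using exhaust_3[of i] exhaust_3[of j] assms unfolding ex forall_3 by (elim disjE) simp_all
  then show ?thesis using that by blast
qed

text \<open>Used in two roles: as coordinates of the exceptional points such as (1 : -1 : 0), and as
  a tangent direction at points whose i-th and j-th coordinates agree.\<close>

definition opposite :: "3 \<Rightarrow> 3 \<Rightarrow> complex ^ 3" where
  "opposite i j = axis i 1 - axis j 1"

lemma opposite_nonzero: "i \<noteq> j \<Longrightarrow> opposite i j \<noteq> 0"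
  unfolding opposite_def axis_def Finite_Cartesian_Product.vec_eq_iff by (auto intro!: exI[of _ i])

text \<open>The transposition of i and j fixes v and negates the direction, so f is even along this
  line.\<close>

lemma tangent_opposite:
  assumes f: "homogeneous3 d f" "symmetric3 f" and "i \<noteq> j" "v $ i = v $ j" "eval3 f v = 0"
  shows "tangent f v (opposite i j)"
proof (rule tangent_of_even)
  fix t
  have "v + (- t) *s opposite i j = permute_coords (Transposition.transpose i j) (v + t *s opposite i j)"
    using assms(3,4) by (auto simp: Finite_Cartesian_Product.vec_eq_iff opposite_def axis_def Transposition.transpose_def)
  then show "eval3 f (v + (- t) *s opposite i j) = eval3 f (v + t *s opposite i j)"
    by (simp only: eval3_permute_coords[OF f bij_transpose])
qed fact

lemma permute_opposite:
  "i \<noteq> j \<Longrightarrow> permute_coords (Transposition.transpose i j) (opposite i j) = (- 1) *s opposite i j"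
  by (auto simp: Finite_Cartesian_Product.vec_eq_iff opposite_def axis_def Transposition.transpose_def)

text \<open>Swapping i and j negates the vector, and a form of odd degree changes sign under
  negation.\<close>

lemma eval3_opposite_odd:
  assumes f: "homogeneous3 d f" "symmetric3 f" and "i \<noteq> j" "odd d"
  shows "eval3 f (opposite i j) = 0"
proof -
  have "eval3 f (opposite i j) = eval3 f (permute_coords (Transposition.transpose i j) (opposite i j))"
    by (rule eval3_permute_coords[OF f bij_transpose, symmetric])
  also have "\<dots> = - eval3 f (opposite i j)"
    unfolding permute_opposite[OF \<open>i \<noteq> j\<close>] eval3_scale[OF f(1)] using \<open>odd d\<close> by simp
  finally show ?thesis by simp
qed

text \<open>Negation composed with the transposition fixes \<open>opposite i j\<close> and negates
  w, and f is invariant because its degree is even. These w span, together with the point itself,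
  the whole space: f is singular there.\<close>

lemma tangent_at_opposite_even:
  assumes f: "homogeneous3 d f" "symmetric3 f" and "i \<noteq> j" "even d"
    and zero: "eval3 f (opposite i j) = 0" and w: "w $ i = w $ j"
  shows "tangent f (opposite i j) w"
proof (rule tangent_of_even[OF zero])
  fix t
  have "opposite i j + (- t) *s w =
      (- 1) *s permute_coords (Transposition.transpose i j) (opposite i j + t *s w)"
    using assms(3) w by (auto simp: Finite_Cartesian_Product.vec_eq_iff opposite_def axis_def Transposition.transpose_def)
  then have "eval3 f (opposite i j + (- t) *s w) = (- 1) ^ d * eval3 f (opposite i j + t *s w)"
    by (simp only: eval3_scale[OF f(1)] eval3_permute_coords[OF f bij_transpose])
  then show "eval3 f (opposite i j + (- t) *s w) = eval3 f (opposite i j + t *s w)"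
    using \<open>even d\<close> by simp
qed

text \<open>f is tangent along the whole plane w_i = w_j. The derivative of g imposes one linear
  condition on this plane, which has a nonzero solution; \<open>opposite i j\<close> does not lie in
  the plane.\<close>

lemma opposite_common_tangent:
  assumes f: "homogeneous3 d f" "symmetric3 f" and ij: "i \<noteq> j" and d: "even d"
    and zero: "eval3 f (opposite i j) = 0" "eval3 g (opposite i j) = 0"
  obtains w where "tangent f (opposite i j) w" "tangent g (opposite i j) w" "\<And>c. w \<noteq> c *s opposite i j"
proof -
  obtain k where k: "k \<noteq> i" "k \<noteq> j" "\<And>l. l = i \<or> l = j \<or> l = k" using obtain_third[OF ij] by blast
  obtain \<alpha> where deriv: "((\<lambda>t. eval3 g (opposite i j + t *s w)) has_field_derivative
      (\<Sum>l\<in>UNIV. \<alpha> l * w $ l)) (at 0)" for w using eval3_line_deriv by blast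
  obtain a b where ab: "(\<alpha> i + \<alpha> j) * a + \<alpha> k * b = 0" "a \<noteq> 0 \<or> b \<noteq> 0"
    by (rule homogeneous_eq_nontrivial_solution)
  define w :: "complex ^ 3" where "w = (\<chi> l. if l = k then b else a)"
  have w: "w $ i = a" "w $ j = a" "w $ k = b" unfolding w_def using k by auto
  have U: "UNIV = {i, j, k}" using k(3) by auto
  have "(\<Sum>l\<in>UNIV. \<alpha> l * w $ l) = (\<alpha> i + \<alpha> j) * a + \<alpha> k * b"
    unfolding U using ij k(1,2) w by (simp add: algebra_simps)
  then have "tangent g (opposite i j) w" using deriv[of w] ab(1) zero(2) unfolding tangent_def by simp
  moreover have "tangent f (opposite i j) w"
    by (rule tangent_at_opposite_even[OF f ij d zero(1)]) (simp add: w)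
  moreover have "w \<noteq> c *s opposite i j" for c
  proof
    assume eq: "w = c *s opposite i j"
    have "w $ i = c" "w $ j = - c" "w $ k = 0"
      unfolding eq opposite_def axis_def using ij k by auto
    then show False using w ab(2) by auto
  qed
  ultimately show ?thesis using that by blast
qed

lemma homogeneous_line_eq:
  assumes "v \<in> homogeneous_line u"
  shows "homogeneous_line v = homogeneous_line u"
proof -
  obtain c where c: "c \<noteq> 0" "v = c *s u" using assms unfolding homogeneous_line_def by blast
  have "a *s u = (a / c) *s v" for a using c by simp
  then have "a *s u \<in> homogeneous_line v" if "a \<noteq> 0" for a
    using that c(1) unfolding homogeneous_line_def by (metis (mono_tags, lifting) divide_eq_0_iff mem_Collect_eq)
  moreover have "a *s v \<in> homogeneous_line u" if "a \<noteq> 0" for a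
    using that c unfolding homogeneous_line_def by (auto intro!: exI[of _ "a * c"])
  ultimately show ?thesis unfolding homogeneous_line_def[of u] homogeneous_line_def[of v]
    by (auto simp: homogeneous_line_def)
qed

section \<open>Counting the real common zeros\<close>

lemma permute_coords_id: "permute_coords id v = v"
  by (simp add: Finite_Cartesian_Product.vec_eq_iff)

text \<open>Permuting coordinates is precomposition, so the order of composition is reversed: this
  is a right action.\<close>

lemma permute_coords_comp: "permute_coords \<pi> (permute_coords \<sigma> v) = permute_coords (\<sigma> \<circ> \<pi>) v"
  by (simp add: Finite_Cartesian_Product.vec_eq_iff)

lemma permute_coords_scale: "permute_coords \<pi> (c *s v) = c *s permute_coords \<pi> v"
  by (simp add: Finite_Cartesian_Product.vec_eq_iff)

lemma permute_coords_eq_0_iff: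
  assumes "bij \<pi>"
  shows "permute_coords \<pi> v = 0 \<longleftrightarrow> v = 0"
  unfolding Finite_Cartesian_Product.vec_eq_iff using bij_pointE[OF assms]
  by (metis permute_coords_nth zero_index)

definition permute_point :: "(3 \<Rightarrow> 3) \<Rightarrow> point \<Rightarrow> point" where
  "permute_point \<pi> p = permute_coords \<pi> ` p"

lemma permute_point_id: "permute_point id p = p"
  by (simp add: permute_point_def permute_coords_id)

lemma permute_point_comp: "permute_point \<pi> (permute_point \<sigma> p) = permute_point (\<sigma> \<circ> \<pi>) p"
  by (simp add: permute_point_def image_image permute_coords_comp)

lemma permute_point_line: "permute_point \<pi> (homogeneous_line v) = homogeneous_line (permute_coords \<pi> v)"
  unfolding permute_point_def homogeneous_line_def by (force simp: permute_coords_scale)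

text \<open>Freeness makes every orbit a copy of the group of 3! = 6 permutations, and the orbits
  partition R.\<close>

lemma card_free_action:
  assumes fin: "finite R"
    and closed: "\<And>\<pi> p. bij \<pi> \<Longrightarrow> p \<in> R \<Longrightarrow> permute_point \<pi> p \<in> R"
    and free: "\<And>\<pi> p. bij \<pi> \<Longrightarrow> p \<in> R \<Longrightarrow> permute_point \<pi> p = p \<Longrightarrow> \<pi> = id"
  shows "6 dvd card R"
proof -
  define G where "G = {\<pi> :: 3 \<Rightarrow> 3. bij \<pi>}"
  have "G = {\<pi>. \<pi> permutes UNIV}" unfolding G_def by (auto simp: permutes_univ bij_iff)
  then have card_G: "card G = 6"
    using card_permutations[of "UNIV :: 3 set" 3] by (simp add: fact_numeral)
  then have fin_G: "finite G" by (metis card.infinite zero_neq_numeral)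
  have inv_G: "inv_into UNIV \<pi> \<in> G" "\<pi> \<circ> inv_into UNIV \<pi> = id" "inv_into UNIV \<pi> \<circ> \<pi> = id" if "\<pi> \<in> G" for \<pi>
    using that unfolding G_def
    by (auto simp: bij_imp_bij_inv fun_eq_iff bij_is_surj surj_f_inv_f bij_is_inj inv_f_f)
  have comp_G: "\<pi> \<circ> \<sigma> \<in> G" if "\<pi> \<in> G" "\<sigma> \<in> G" for \<pi> \<sigma>
    using that bij_comp unfolding G_def by blast
  define orbit where "orbit p = (\<lambda>\<pi>. permute_point \<pi> p) ` G" for p
  have self: "p \<in> orbit p" for p
    unfolding orbit_def G_def using permute_point_id by (metis bij_id image_eqI mem_Collect_eq)
  have orbit_R: "orbit p \<subseteq> R" if "p \<in> R" for p
    using closed that unfolding orbit_def G_def by blast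
  have orbit_mono: "orbit q \<subseteq> orbit p" if "q \<in> orbit p" for p q
    using that comp_G unfolding orbit_def by (auto simp: permute_point_comp)
  have orbit_sym: "p \<in> orbit q" if q: "q \<in> orbit p" for p q
  proof -
    obtain \<pi> where \<pi>: "\<pi> \<in> G" "q = permute_point \<pi> p" using q unfolding orbit_def by blast
    then have "p = permute_point (inv_into UNIV \<pi>) q"
      using inv_G(2) by (simp add: permute_point_comp permute_point_id)
    then show ?thesis using inv_G(1)[OF \<pi>(1)] unfolding orbit_def by blast
  qed
  have "inj_on (\<lambda>\<pi>. permute_point \<pi> p) G" if "p \<in> R" for p
  proof (rule inj_onI)
    fix \<pi> \<sigma> assume \<pi>: "\<pi> \<in> G" and \<sigma>: "\<sigma> \<in> G" and eq: "permute_point \<pi> p = permute_point \<sigma> p"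
    \<comment> \<open>As the action is from the right, it is this composite that fixes p.\<close>
    have "permute_point (\<pi> \<circ> inv_into UNIV \<sigma>) p = permute_point (inv_into UNIV \<sigma>) (permute_point \<sigma> p)"
      unfolding permute_point_comp[symmetric] eq ..
    also have "\<dots> = p" using inv_G(2)[OF \<sigma>] by (simp add: permute_point_comp permute_point_id)
    finally have "\<pi> \<circ> inv_into UNIV \<sigma> = id"
      using free[of "\<pi> \<circ> inv_into UNIV \<sigma>" p] comp_G[OF \<pi> inv_G(1)[OF \<sigma>]] that unfolding G_def by blast
    then have "\<pi> \<circ> (inv_into UNIV \<sigma> \<circ> \<sigma>) = \<sigma>" by (metis comp_assoc id_comp)
    then show "\<pi> = \<sigma>" using inv_G(3)[OF \<sigma>] by simp
  qed
  then have card_orbit: "card (orbit p) = 6" if "p \<in> R" for p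
    unfolding orbit_def using that card_G by (simp add: card_image)
  have "6 * card (orbit ` R) = card (\<Union>(orbit ` R))"
  proof (rule card_partition)
    have R: "\<Union>(orbit ` R) = R" using self orbit_R by blast
    show "finite (orbit ` R)" "finite (\<Union>(orbit ` R))" using fin R by auto
    show "card c = 6" if "c \<in> orbit ` R" for c using that card_orbit by blast
    show "c1 \<inter> c2 = {}" if "c1 \<in> orbit ` R" "c2 \<in> orbit ` R" "c1 \<noteq> c2" for c1 c2
      using that orbit_mono orbit_sym by blast
  qed
  moreover have "\<Union>(orbit ` R) = R" using self orbit_R by blast
  ultimately show ?thesis by (metis dvd_triv_left)
qed

section \<open>The three exceptional points\<close>

definition opposite_points :: "point set" where
  "opposite_points = {homogeneous_line (opposite i j) | i j. i \<noteq> j}"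

lemma card_opposite_points: "card opposite_points = 3" "finite opposite_points"
proof -
  have sym: "homogeneous_line (opposite j i) = homogeneous_line (opposite i j)" for i j
    by (rule homogeneous_line_eq) (auto simp: homogeneous_line_def opposite_def intro!: exI[of _ "- 1"])
  have "{(i, j). i \<noteq> j} = {(1, 2), (2, 1), (1, 3), (3, 1), (2, 3), (3, 2 :: 3)}"
    using exhaust_3 by (auto; metis)
  moreover have "opposite_points = (\<lambda>(i, j). homogeneous_line (opposite i j)) ` {(i, j). i \<noteq> j}"
    unfolding opposite_points_def by auto
  ultimately have S: "opposite_points = {homogeneous_line (opposite 1 2), homogeneous_line (opposite 1 3),
      homogeneous_line (opposite 2 3)}"
    using sym[of 1 2] sym[of 1 3] sym[of 2 3] by auto
  \<comment> \<open>Two of the points are told apart by a coordinate that vanishes on one of them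
    only.\<close>
  have ne: "homogeneous_line (opposite i j) \<noteq> homogeneous_line v" if "v $ k \<noteq> 0" "k \<noteq> i" "k \<noteq> j" for i j k v
  proof
    assume "homogeneous_line (opposite i j) = homogeneous_line v"
    then obtain c where "v = c *s opposite i j"
      using homogeneous_line_self[of v] unfolding homogeneous_line_def by auto
    then show False using that by (simp add: opposite_def axis_def)
  qed
  have "homogeneous_line (opposite 1 2) \<noteq> homogeneous_line (opposite 1 3)"
    "homogeneous_line (opposite 1 2) \<noteq> homogeneous_line (opposite 2 3)"
    by (rule ne[where k = 3]; simp add: opposite_def axis_def)+
  moreover have "homogeneous_line (opposite 1 3) \<noteq> homogeneous_line (opposite 2 3)"
    by (rule ne[where k = 2]; simp add: opposite_def axis_def)
  ultimately show "card opposite_points = 3" unfolding S by simp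
  show "finite opposite_points" unfolding S by simp
qed

text \<open>Stated backwards because it serves to keep the complement of
  \<open>opposite_points\<close> stable under the action.\<close>

lemma permute_opposite_points:
  assumes \<pi>: "bij \<pi>" and p: "permute_point \<pi> p \<in> opposite_points"
  shows "p \<in> opposite_points"
proof -
  obtain i j where ij: "i \<noteq> j" and eq: "permute_point \<pi> p = homogeneous_line (opposite i j)"
    using p unfolding opposite_points_def by blast
  have inv: "\<pi> (inv_into UNIV \<pi> k) = k" "inv_into UNIV \<pi> (\<pi> k) = k" for k
    using \<pi> by (simp_all add: bij_is_surj surj_f_inv_f bij_is_inj)
  have "p = permute_point (inv_into UNIV \<pi>) (permute_point \<pi> p)"
    by (simp add: permute_point_comp) (simp add: comp_def inv permute_point_id[unfolded id_def])
  also have "\<dots> = homogeneous_line (permute_coords (inv_into UNIV \<pi>) (opposite i j))"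
    unfolding eq permute_point_line ..
  also have "permute_coords (inv_into UNIV \<pi>) (opposite i j) = opposite (\<pi> i) (\<pi> j)"
    using inv by (simp add: Finite_Cartesian_Product.vec_eq_iff opposite_def axis_def) metis
  finally show ?thesis using ij inv(2) unfolding opposite_points_def by (metis (mono_tags, lifting) mem_Collect_eq)
qed

text \<open>This is where reality enters the freeness argument. Over the complex numbers (1,
  \<omega>, \<omega>^2) with a primitive cube root of unity \<omega> has sum of squares 0 and is
  only rescaled by a 3-cycle.\<close>

lemma sum_squares_real_nonzero:
  fixes v :: "complex ^ 3"
  assumes "v \<noteq> 0" "\<And>i. v $ i \<in> \<real>"
  shows "(\<Sum>i\<in>UNIV. (v $ i)\<^sup>2) \<noteq> 0"
proof -
  have r: "v $ i = complex_of_real (Re (v $ i))" for i using assms(2) by simp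
  then have "(\<Sum>i\<in>UNIV. (v $ i)\<^sup>2) = complex_of_real (\<Sum>i\<in>UNIV. (Re (v $ i))\<^sup>2)"
    by (metis (mono_tags, lifting) of_real_power of_real_sum sum.cong)
  moreover have "(\<Sum>i\<in>UNIV. (Re (v $ i))\<^sup>2) \<noteq> 0"
  proof
    assume "(\<Sum>i\<in>UNIV. (Re (v $ i))\<^sup>2) = 0"
    then have "Re (v $ i) = 0" for i by (simp add: sum_nonneg_eq_0_iff)
    then have "v $ i = 0" for i using r by (metis of_real_0)
    then show False using assms(1) by (simp add: Finite_Cartesian_Product.vec_eq_iff)
  qed
  ultimately show ?thesis by (metis of_real_eq_0_iff)
qed

section \<open>Real common zeros of two transverse symmetric curves\<close>

locale transverse_symmetric_curves =
  fixes f g :: "real poly3" and d e :: nat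
  assumes f: "real_symmetric_curve d f" and g: "real_symmetric_curve e g"
    and transverse: "transverse f g"
begin

abbreviation "f\<^sub>C \<equiv> complexify f"
abbreviation "g\<^sub>C \<equiv> complexify g"

lemma forms: "homogeneous3 d f\<^sub>C" "symmetric3 f\<^sub>C" "homogeneous3 e g\<^sub>C" "symmetric3 g\<^sub>C" "d \<ge> 1" "e \<ge> 1"
  using f g unfolding real_symmetric_curve_def
  by (simp_all add: homogeneous3_complexify symmetric3_complexify)

lemma line_common_zeros_iff:
  assumes "v \<noteq> 0"
  shows "homogeneous_line v \<in> common_zeros f g \<longleftrightarrow> eval3 f\<^sub>C v = 0 \<and> eval3 g\<^sub>C v = 0"
proof
  assume "homogeneous_line v \<in> common_zeros f g"
  then show "eval3 f\<^sub>C v = 0 \<and> eval3 g\<^sub>C v = 0"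
    using homogeneous_line_self[of v] unfolding common_zeros_def by blast
next
  assume "eval3 f\<^sub>C v = 0 \<and> eval3 g\<^sub>C v = 0"
  then show "homogeneous_line v \<in> common_zeros f g"
    using assms unfolding common_zeros_def proj_plane_eq
    by (auto simp: homogeneous_line_def eval3_scale[OF forms(1)] eval3_scale[OF forms(3)])
qed

lemma common_zeros_lines:
  assumes "p \<in> common_zeros f g" "v \<in> p"
  shows "v \<noteq> 0" "p = homogeneous_line v"
proof -
  obtain u where u: "u \<noteq> 0" "p = homogeneous_line u"
    using assms(1) unfolding common_zeros_def proj_plane_eq by blast
  then show "p = homogeneous_line v" using homogeneous_line_eq assms(2) by blast
  show "v \<noteq> 0" using u assms(2) unfolding homogeneous_line_def by auto
qed

lemma no_common_tangent: "no_common_tangent f\<^sub>C g\<^sub>C"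
  unfolding no_common_tangent_def
proof (intro allI impI)
  fix v w :: "complex ^ 3"
  assume v: "v \<noteq> 0" and t: "tangent f\<^sub>C v w" "tangent g\<^sub>C v w"
  then have "homogeneous_line v \<in> common_zeros f g"
    unfolding line_common_zeros_iff[OF v] tangent_def by blast
  then have "intersection_multiplicity f g (homogeneous_line v) = 1"
    using transverse unfolding transverse_def by blast
  then show "\<exists>c. w = c *s v"
    using intersection_multiplicity_1_tangent[OF _ refl v t] by blast
qed

text \<open>If the i-th and j-th coordinates agreed, \<open>opposite i j\<close> would be a common
  tangent direction; it is not a multiple of v, because its own i-th and j-th coordinates
  differ.\<close>

lemma distinct_coords:
  assumes "v \<noteq> 0" and zero: "eval3 f\<^sub>C v = 0" "eval3 g\<^sub>C v = 0" and "i \<noteq> j"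
  shows "v $ i \<noteq> v $ j"
proof
  assume eq: "v $ i = v $ j"
  have "tangent f\<^sub>C v (opposite i j)" "tangent g\<^sub>C v (opposite i j)"
    using tangent_opposite forms assms eq by blast+
  then obtain c where "opposite i j = c *s v"
    using no_common_tangent \<open>v \<noteq> 0\<close> unfolding no_common_tangent_def by blast
  then have "opposite i j $ i = opposite i j $ j" using eq by simp
  then show False using \<open>i \<noteq> j\<close> unfolding opposite_def axis_def by simp
qed

lemma opposite_points_odd:
  assumes "odd (d * e)"
  shows "opposite_points \<subseteq> real_common_zeros f g"
proof
  fix p assume "p \<in> opposite_points"
  then obtain i j where ij: "i \<noteq> j" and p: "p = homogeneous_line (opposite i j)"
    unfolding opposite_points_def by blast
  have "eval3 f\<^sub>C (opposite i j) = 0" "eval3 g\<^sub>C (opposite i j) = 0"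
    using eval3_opposite_odd forms ij assms by auto
  then have "p \<in> common_zeros f g"
    unfolding p line_common_zeros_iff[OF opposite_nonzero[OF ij]] by blast
  moreover have "real_point p"
    unfolding real_point_def p
    by (rule bexI[OF _ homogeneous_line_self]) (simp add: opposite_def axis_def)
  ultimately show "p \<in> real_common_zeros f g" unfolding real_common_zeros_def by blast
qed

text \<open>One of the degrees is even, and that curve would be singular at such a common zero,
  contrary to transversality.\<close>

lemma opposite_points_even:
  assumes "even (d * e)"
  shows "opposite_points \<inter> common_zeros f g = {}"
proof (rule ccontr)
  assume "\<not> ?thesis"
  then obtain i j where ij: "i \<noteq> j" and "homogeneous_line (opposite i j) \<in> common_zeros f g"
    unfolding opposite_points_def by blast
  then have zero: "eval3 f\<^sub>C (opposite i j) = 0" "eval3 g\<^sub>C (opposite i j) = 0"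
    unfolding line_common_zeros_iff[OF opposite_nonzero[OF ij]] by blast+
  obtain w where "tangent f\<^sub>C (opposite i j) w" "tangent g\<^sub>C (opposite i j) w" "\<And>c. w \<noteq> c *s opposite i j"
  proof (cases "even d")
    case True
    then show ?thesis using opposite_common_tangent[OF forms(1,2) ij _ zero] that by metis
  next
    case False
    then have "even e" using assms by simp
    then show ?thesis using opposite_common_tangent[OF forms(3,4) ij _ zero(2,1)] that by metis
  qed
  then show False using no_common_tangent opposite_nonzero[OF ij] unfolding no_common_tangent_def by blast
qed

lemma permute_real_common_zeros:
  assumes \<pi>: "bij \<pi>" and p: "p \<in> real_common_zeros f g"
  shows "permute_point \<pi> p \<in> real_common_zeros f g"
proof -
  obtain v where v: "v \<in> p" "\<And>i. v $ i \<in> \<real>" and pz: "p \<in> common_zeros f g"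
    using p unfolding real_common_zeros_def real_point_def by blast
  note line = common_zeros_lines[OF pz v(1)]
  have nonzero: "permute_coords \<pi> v \<noteq> 0" using line(1) permute_coords_eq_0_iff[OF \<pi>] by blast
  have "eval3 f\<^sub>C v = 0 \<and> eval3 g\<^sub>C v = 0" using pz line line_common_zeros_iff by auto
  then have "homogeneous_line (permute_coords \<pi> v) \<in> common_zeros f g"
    unfolding line_common_zeros_iff[OF nonzero] eval3_permute_coords[OF forms(1,2) \<pi>]
      eval3_permute_coords[OF forms(3,4) \<pi>] .
  moreover have "real_point (homogeneous_line (permute_coords \<pi> v))"
    unfolding real_point_def by (rule bexI[OF _ homogeneous_line_self]) (simp add: v(2))
  ultimately show ?thesis unfolding real_common_zeros_def line(2) permute_point_line by blast
qed

text \<open>A permutation fixing the point scales a real vector v by some c, and the invariant sum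
  of squares gives c^2 = 1. For c = 1 the distinctness of the coordinates forces the identity; for c
  = -1 the point is one of \<open>opposite_points\<close>.\<close>

lemma free_on_other_points:
  assumes \<pi>: "bij \<pi>" and p: "p \<in> real_common_zeros f g - opposite_points" and fixed: "permute_point \<pi> p = p"
  shows "\<pi> = id"
proof -
  obtain v where v: "v \<in> p" "\<And>i. v $ i \<in> \<real>" and pz: "p \<in> common_zeros f g"
    using p unfolding real_common_zeros_def real_point_def by blast
  note line = common_zeros_lines[OF pz v(1)]
  have zero: "eval3 f\<^sub>C v = 0" "eval3 g\<^sub>C v = 0" using pz line line_common_zeros_iff by auto
  have distinct: "i = j" if "v $ i = v $ j" for i j
    using distinct_coords[OF line(1) zero] that by blast
  have "permute_coords \<pi> v \<in> p" using fixed v(1) unfolding permute_point_def by blast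
  then obtain c where c: "permute_coords \<pi> v = c *s v" using line(2) unfolding homogeneous_line_def by blast
  have c_nth: "v $ \<pi> i = c * v $ i" for i
    using arg_cong[OF c, of "\<lambda>u. u $ i"] by simp
  have "(\<Sum>i\<in>UNIV. (v $ i)\<^sup>2) = (\<Sum>i\<in>UNIV. (v $ \<pi> i)\<^sup>2)"
    by (rule sum.reindex_bij_betw[OF \<pi>, symmetric])
  also have "\<dots> = c\<^sup>2 * (\<Sum>i\<in>UNIV. (v $ i)\<^sup>2)"
    by (simp add: c_nth power_mult_distrib sum_distrib_left)
  finally have "c\<^sup>2 = 1" using sum_squares_real_nonzero[OF line(1) v(2)] by simp
  then consider "c = 1" | "c = - 1" using power2_eq_1_iff by blast
  then show ?thesis
  proof cases
    case 1
    then show ?thesis using c_nth distinct by (simp add: fun_eq_iff)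
  next
    case 2
    \<comment> \<open>The sum and the product of the coordinates are symmetric of odd degree, so
      both change sign and vanish. Hence one coordinate is 0 and the other two are opposite.\<close>
    have "(\<Sum>i\<in>UNIV. v $ i) = (\<Sum>i\<in>UNIV. v $ \<pi> i)"
      by (rule sum.reindex_bij_betw[OF \<pi>, symmetric])
    then have sum: "(\<Sum>i\<in>UNIV. v $ i) = 0" unfolding c_nth 2 by (simp add: sum_negf)
    have "(\<Prod>i\<in>UNIV. v $ i) = (\<Prod>i\<in>UNIV. v $ \<pi> i)"
      by (rule prod.reindex_bij_betw[OF \<pi>, symmetric])
    then have "(\<Prod>i\<in>UNIV. v $ i) = 0" unfolding c_nth 2 by (simp add: prod_3)
    then obtain k where k: "v $ k = 0" by auto
    obtain i where "i \<noteq> k" using exhaust_3 by (metis zero_neq_one)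
    then obtain j where j: "j \<noteq> i" "j \<noteq> k" "\<And>l. l = i \<or> l = k \<or> l = j" using obtain_third by metis
    have U: "UNIV = {i, j, k}" using j(3) by blast
    have "v $ i + v $ j = 0" using sum k j \<open>i \<noteq> k\<close> unfolding U by simp
    then have vj: "v $ j = - v $ i" by (simp add: add_eq_0_iff)
    have v_eq: "v = v $ i *s opposite i j"
      unfolding Finite_Cartesian_Product.vec_eq_iff
    proof
      fix l
      show "v $ l = (v $ i *s opposite i j) $ l"
        using j(3)[of l] j(1,2) \<open>i \<noteq> k\<close> k vj by (auto simp: opposite_def axis_def)
    qed
    then have "v $ i \<noteq> 0" using line(1) by auto
    then have "v \<in> homogeneous_line (opposite i j)" using v_eq unfolding homogeneous_line_def by blast
    then have "p \<in> opposite_points"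
      using homogeneous_line_eq line(2) j(1) unfolding opposite_points_def by blast
    then show ?thesis using p by blast
  qed
qed

lemma real_common_zeros_bound: "finite (real_common_zeros f g) \<and> card (real_common_zeros f g) \<le> d * e"
\<comment> \<open>Finiteness is not known in advance; bounding every finite subset by de yields
  finiteness and the bound together.\<close>
proof (rule finite_if_finite_subsets_card_bdd)
  fix R assume R: "R \<subseteq> real_common_zeros f g" and fin: "finite R"
  have pz: "p \<in> common_zeros f g" if "p \<in> R" for p using R that unfolding real_common_zeros_def by blast
  have "\<exists>v. v \<in> p" if "p \<in> R" for p
    using R that unfolding real_common_zeros_def real_point_def by blast
  then obtain r where r: "\<And>p. p \<in> R \<Longrightarrow> r p \<in> p" by metis
  have lines: "r p \<noteq> 0" "p = homogeneous_line (r p)" if "p \<in> R" for p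
    using common_zeros_lines[OF pz r] that by blast+
  have inj: "p = q" if "p \<in> R" "q \<in> R" "r q = c *s r p" for p q c
  proof -
    have "c \<noteq> 0" using lines(1)[OF that(2)] that(3) by auto
    then have "r q \<in> homogeneous_line (r p)" using that(3) unfolding homogeneous_line_def by blast
    then show ?thesis using homogeneous_line_eq lines(2) that(1,2) by metis
  qed
  have "card (r ` R) \<le> d * e"
  proof (rule card_common_zeros_le[OF forms(1,3,6) no_common_tangent])
    show "finite (r ` R)" using fin by simp
    show "v \<noteq> 0 \<and> eval3 f\<^sub>C v = 0 \<and> eval3 g\<^sub>C v = 0" if "v \<in> r ` R" for v
      using that lines pz line_common_zeros_iff by (metis imageE)
    show "v \<noteq> c *s u" if uv: "u \<in> r ` R" "v \<in> r ` R" "u \<noteq> v" for u v c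
    proof
      obtain p q where pq: "p \<in> R" "q \<in> R" "u = r p" "v = r q" using uv(1,2) by blast
      assume "v = c *s u"
      then have "r q = c *s r p" unfolding pq(3,4) .
      then have "p = q" by (rule inj[OF pq(1,2)])
      then show False using uv(3) pq(3,4) by simp
    qed
  qed
  moreover have "inj_on r R" by (rule inj_onI) (metis inj vector_smult_lid)
  ultimately show "card R \<le> d * e" by (simp add: card_image)
qed

lemma other_points: "6 dvd card (real_common_zeros f g - opposite_points)"
proof (rule card_free_action)
  show "finite (real_common_zeros f g - opposite_points)" using real_common_zeros_bound by blast
  show "permute_point \<pi> p \<in> real_common_zeros f g - opposite_points"
    if "bij \<pi>" "p \<in> real_common_zeros f g - opposite_points" for \<pi> p
    using that permute_real_common_zeros permute_opposite_points by blast
qed (rule free_on_other_points)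

lemma card_real_common_zeros_odd:
  assumes "odd (d * e)"
  obtains k where "card (real_common_zeros f g) = 3 + 6 * k"
proof -
  obtain k where "card (real_common_zeros f g - opposite_points) = 6 * k" using other_points by blast
  moreover have "card (real_common_zeros f g) = card (real_common_zeros f g - opposite_points) + 3"
    using card_Diff_subset[OF card_opposite_points(2) opposite_points_odd[OF assms]]
      card_mono[OF _ opposite_points_odd[OF assms]] real_common_zeros_bound card_opposite_points(1) by simp
  ultimately show ?thesis using that by simp
qed

lemma card_real_common_zeros_even:
  assumes "even (d * e)"
  obtains k where "card (real_common_zeros f g) = 6 * k"
proof -
  have "real_common_zeros f g - opposite_points = real_common_zeros f g"
    using opposite_points_even[OF assms] unfolding real_common_zeros_def by blast
  then show ?thesis using other_points that by (metis dvdE)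
qed

end

theorem theorem1p2:
  fixes f g :: "real poly3" and d e :: nat
  assumes "real_symmetric_curve d f"
    and "real_symmetric_curve e g"
    and "transverse f g"
  shows "((d * e) mod 6 = 3 \<or> (d * e) mod 6 = 5 \<longrightarrow>
            (\<exists>k::int. 0 \<le> k \<and> real_of_int k < real (d * e) / 6 \<and>
               finite (real_common_zeros f g) \<and> int (card (real_common_zeros f g)) = 3 + 6 * k))
       \<and> ((d * e) mod 6 = 0 \<or> (d * e) mod 6 = 2 \<longrightarrow>
            (\<exists>k::int. 0 \<le> k \<and> real_of_int k \<le> real (d * e) / 6 \<and>
               finite (real_common_zeros f g) \<and> int (card (real_common_zeros f g)) = 6 * k))"
proof -
  interpret transverse_symmetric_curves f g d e using assms by unfold_locales
  have fin: "finite (real_common_zeros f g)" and bound: "card (real_common_zeros f g) \<le> d * e"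
    using real_common_zeros_bound by blast+
  show ?thesis
  proof (intro conjI impI)
    assume "(d * e) mod 6 = 3 \<or> (d * e) mod 6 = 5"
    then have "odd (d * e)" by presburger
    then obtain k where k: "card (real_common_zeros f g) = 3 + 6 * k"
      by (rule card_real_common_zeros_odd)
    \<comment> \<open>The three exceptional points make the inequality strict: 3 + 6k is at most
      de.\<close>
    then have "6 * k < d * e" using bound by simp
    then have "real k < real (d * e) / 6" by (simp flip: of_nat_mult)
    then show "\<exists>k::int. 0 \<le> k \<and> real_of_int k < real (d * e) / 6 \<and>
        finite (real_common_zeros f g) \<and> int (card (real_common_zeros f g)) = 3 + 6 * k"
      using fin k by (intro exI[of _ "int k"]) simp
  next
    assume "(d * e) mod 6 = 0 \<or> (d * e) mod 6 = 2"
    then have "even (d * e)" by presburger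
    then obtain k where k: "card (real_common_zeros f g) = 6 * k"
      by (rule card_real_common_zeros_even)
    then have "6 * k \<le> d * e" using bound by simp
    then have "real k \<le> real (d * e) / 6" by (simp flip: of_nat_mult)
    then show "\<exists>k::int. 0 \<le> k \<and> real_of_int k \<le> real (d * e) / 6 \<and>
        finite (real_common_zeros f g) \<and> int (card (real_common_zeros f g)) = 6 * k"
      using fin k by (intro exI[of _ "int k"]) simp
  qed
qed

end
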